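(* Let $L:Q^2\times\mathbb{R}^2\to\mathbb{R}$ be a non-degenerate discrete Lagrangian with sufficiently small step size $h>0$ (see context). The map $$Q^2\times\mathbb{R}\to Q^2\times\mathbb{R}:\ (x_{j-1},x_j,z_{j-1})\mapsto(x_j,x_{j+1},z_j)$$ given by the discrete generalized Euler-Lagrange equations induces a map $$F:T^*Q\times\mathbb{R}\to T^*Q\times\mathbb{R}:\ (x_{j-1},p_{j-1},z_{j-1})\mapsto(x_j,p_j,z_j),$$ where $p_j=p_j^-=p_j^+$ and $$p_j^-=\frac{h\,\mathrm{D}_2L(x_{j-1},x_j,z_{j-1},z_j)}{1-h\,\mathrm{D}_4L(x_{j-1},x_j,z_{j-1},z_j)},\qquad p_j^+=-\frac{h\,\mathrm{D}_1L(x_j,x_{j+1},z_j,z_{j+1})}{1+h\,\mathrm{D}_3L(x_j,x_{j+1},z_j,z_{j+1})}$$ (in particular, the two expressions $p_j^-$ and $p_j^+$ agree on solutions). The map $F$ is a contact transformation with respect to the 1-form $\mathrm{d}z-p\,\mathrm{d}x$.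
   Context: $Q$ is an $n$-dimensional smooth manifold described in local coordinates $x=(x^1,\ldots,x^n)$; $(x,p,z)$ are the induced coordinates on $T^*Q\times\mathbb{R}$, and $\mathrm{d}z-p\,\mathrm{d}x$ is short for $\mathrm{d}z-\sum_i p_i\,\mathrm{d}x^i$. The discrete Lagrangian $L=L(x_j,x_{j+1},z_j,z_{j+1})$ is smooth and may depend on the fixed step size $h>0$, which is omitted from the notation. $\mathrm{D}_iL$ is the partial derivative with respect to the $i$-th entry. The values $z_j$ satisfy $$z_{j+1}-z_j=hL(x_j,x_{j+1},z_j,z_{j+1}),$$ and the discrete generalized Euler-Lagrange equations are $$\mathrm{D}_1L(x_j,x_{j+1},z_j,z_{j+1})+\mathrm{D}_2L(x_{j-1},x_j,z_{j-1},z_j)\,\frac{1+h\,\mathrm{D}_3L(x_j,x_{j+1},z_j,z_{j+1})}{1-h\,\mathrm{D}_4L(x_{j-1},x_j,z_{j-1},z_j)}=0.$$ Standing assumptions: $L$ is non-degenerate, i.e. $\det\big(\mathrm{D}_1\mathrm{D}_2L(x_j,x_{j+1},z_j,z_{j+1})\big)\neq0$, and $h$ is sufficiently small. The latter means that $1-h\mathrm{D}_4L\neq0$ and $1+h\mathrm{D}_3L\neq0$; that the relation $z_{j+1}-z_j=hL(x_j,x_{j+1},z_j,z_{j+1})$ determines $z_{j+1}$ as a smooth function of $(x_j,x_{j+1},z_j)$; and that, with $z_{j+1}$ regarded as this function, the discrete generalized Euler-Lagrange equations can be solved for $x_{j+1}$ by the implicit function theorem (the Jacobian with respect to $x_{j+1}$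 is invertible at solutions). All maps are understood to be local, i.e. defined where these equations are solved. A contact transformation with respect to $\eta=\mathrm{d}z-p\,\mathrm{d}x$ is a map $F$ with $F^*\eta=f\,\eta$ for some nowhere vanishing function $f$. *)

theory Defs
  imports "HOL-Analysis.Analysis"
begin

section \<open>Smooth maps and smooth manifolds\<close>

text \<open>Maps of class \<open>C\<^sup>k\<close> and \<open>C\<^sup>\<infinity>\<close> on an open subset of a Euclidean space. The set is meant to be open.\<close>

primrec Ck_on :: "nat \<Rightarrow> 'a::euclidean_space set \<Rightarrow> ('a \<Rightarrow> 'b::real_normed_vector) \<Rightarrow> bool" where
  "Ck_on 0 S f \<longleftrightarrow> continuous_on S f"
| "Ck_on (Suc k) S f \<longleftrightarrow>
     f differentiable_on S \<and> (\<forall>v. Ck_on k S (\<lambda>x. frechet_derivative f (at x) v))"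

definition smooth_on :: "'a::euclidean_space set \<Rightarrow> ('a \<Rightarrow> 'b::real_normed_vector) \<Rightarrow> bool" where
  "smooth_on S f \<longleftrightarrow> (\<forall>k. Ck_on k S f)"

text \<open>A chart is a pair of its domain and its coordinate map. The manifold \<open>Q\<close> is the union of
  the domains of the charts in an atlas, and \<open>n = CARD('n)\<close>.\<close>

type_synonym ('q, 'n) chart = "'q set \<times> ('q \<Rightarrow> real^'n)"

definition img :: "('q, 'n::finite) chart \<Rightarrow> (real^'n) set" where
  "img c = snd c ` fst c"

definition pt :: "('q, 'n::finite) chart \<Rightarrow> real^'n \<Rightarrow> 'q" where
  "pt c = inv_into (fst c) (snd c)"

definition smooth_atlas ::
    "('q::{t2_space, second_countable_topology}, 'n::finite) chart set \<Rightarrow> bool" where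
  "smooth_atlas A \<longleftrightarrow>
     (\<forall>c\<in>A. open (fst c) \<and> open (img c) \<and> homeomorphism (fst c) (img c) (snd c) (pt c)) \<and>
     (\<forall>c\<in>A. \<forall>d\<in>A. smooth_on (snd c ` (fst c \<inter> fst d)) (snd d \<circ> pt c))"


section \<open>Discrete Lagrangians in local coordinates\<close>

type_synonym 'n coord_lagrangian = "real^'n \<Rightarrow> real^'n \<Rightarrow> real \<Rightarrow> real \<Rightarrow> real"

definition in_charts ::
    "('q \<Rightarrow> 'q \<Rightarrow> real \<Rightarrow> real \<Rightarrow> real) \<Rightarrow> ('q, 'n::finite) chart \<Rightarrow> ('q, 'n) chart \<Rightarrow> 'n coord_lagrangian" where
  "in_charts L c d = (\<lambda>x y z w. L (pt c x) (pt d y) z w)"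

definition smooth_lagrangian ::
    "('q, 'n::finite) chart set \<Rightarrow> ('q \<Rightarrow> 'q \<Rightarrow> real \<Rightarrow> real \<Rightarrow> real) \<Rightarrow> bool" where
  "smooth_lagrangian A L \<longleftrightarrow>
     (\<forall>c\<in>A. \<forall>d\<in>A. smooth_on (img c \<times> img d \<times> UNIV \<times> UNIV)
        (\<lambda>(x, y, z, w). in_charts L c d x y z w))"

definition grad :: "(real^'n::finite \<Rightarrow> real) \<Rightarrow> real^'n \<Rightarrow> real^'n" where
  "grad f x = (\<chi> i. frechet_derivative f (at x) (axis i 1))"

definition D1 :: "'n::finite coord_lagrangian \<Rightarrow> real^'n \<Rightarrow> real^'n \<Rightarrow> real \<Rightarrow> real \<Rightarrow> real^'n" where
  "D1 l x y z w = grad (\<lambda>x'. l x' y z w) x"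

definition D2 :: "'n::finite coord_lagrangian \<Rightarrow> real^'n \<Rightarrow> real^'n \<Rightarrow> real \<Rightarrow> real \<Rightarrow> real^'n" where
  "D2 l x y z w = grad (\<lambda>y'. l x y' z w) y"

definition D3 :: "'n::finite coord_lagrangian \<Rightarrow> real^'n \<Rightarrow> real^'n \<Rightarrow> real \<Rightarrow> real \<Rightarrow> real" where
  "D3 l x y z w = deriv (\<lambda>z'. l x y z' w) z"

definition D4 :: "'n::finite coord_lagrangian \<Rightarrow> real^'n \<Rightarrow> real^'n \<Rightarrow> real \<Rightarrow> real \<Rightarrow> real" where
  "D4 l x y z w = deriv (\<lambda>w'. l x y z w') w"

definition nondegenerate ::
    "('q, 'n::finite) chart set \<Rightarrow> ('q \<Rightarrow> 'q \<Rightarrow> real \<Rightarrow> real \<Rightarrow> real) \<Rightarrow> bool" where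
  "nondegenerate A L \<longleftrightarrow>
     (\<forall>c\<in>A. \<forall>d\<in>A. \<forall>x\<in>img c. \<forall>y\<in>img d. \<forall>z w.
        det (jacobian (\<lambda>x'. D2 (in_charts L c d) x' y z w) (at x)) \<noteq> 0)"


section \<open>Discrete generalized Euler-Lagrange equations\<close>

text \<open>In what follows \<open>l\<close> represents \<open>L\<close> in charts around \<open>x\<^sub>j\<^sub>-\<^sub>1\<close>, \<open>x\<^sub>j\<close>,
  and \<open>k\<close> represents \<open>L\<close> in charts around \<open>x\<^sub>j\<close>, \<open>x\<^sub>j\<^sub>+\<^sub>1\<close>. The same chart is used around \<open>x\<^sub>j\<close>
  in both, so that the covectors at \<open>x\<^sub>j\<close> can be compared.\<close>

definition z_rel ::
    "real \<Rightarrow> 'n::finite coord_lagrangian \<Rightarrow> real^'n \<Rightarrow> real^'n \<Rightarrow> real \<Rightarrow> real \<Rightarrow> bool" where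
  "z_rel h l x y z w \<longleftrightarrow> w - z = h * l x y z w"

definition dgel_lhs ::
    "real \<Rightarrow> 'n::finite coord_lagrangian \<Rightarrow> 'n coord_lagrangian
       \<Rightarrow> real^'n \<Rightarrow> real^'n \<Rightarrow> real^'n \<Rightarrow> real \<Rightarrow> real \<Rightarrow> real \<Rightarrow> real^'n" where
  "dgel_lhs h l k x0 x1 x2 z0 z1 z2 =
     D1 k x1 x2 z1 z2 +
     ((1 + h * D3 k x1 x2 z1 z2) / (1 - h * D4 l x0 x1 z0 z1)) *\<^sub>R D2 l x0 x1 z0 z1"

definition dgel_solution ::
    "real \<Rightarrow> 'n::finite coord_lagrangian \<Rightarrow> 'n coord_lagrangian
       \<Rightarrow> real^'n \<Rightarrow> real^'n \<Rightarrow> real^'n \<Rightarrow> real \<Rightarrow> real \<Rightarrow> real \<Rightarrow> bool" where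
  "dgel_solution h l k x0 x1 x2 z0 z1 z2 \<longleftrightarrow>
     z_rel h l x0 x1 z0 z1 \<and> z_rel h k x1 x2 z1 z2 \<and> dgel_lhs h l k x0 x1 x2 z0 z1 z2 = 0"

text \<open>Near \<open>(x, y, z, w)\<close> the relation \<open>w' - z' = h l(x', y', z', w')\<close> determines \<open>w'\<close> as the
  smooth function \<open>\<zeta>\<close> of \<open>(x', y', z')\<close>.\<close>

definition resolves_z ::
    "real \<Rightarrow> 'n::finite coord_lagrangian \<Rightarrow> real^'n \<Rightarrow> real^'n \<Rightarrow> real \<Rightarrow> real
       \<Rightarrow> (real^'n \<Rightarrow> real^'n \<Rightarrow> real \<Rightarrow> real) \<Rightarrow> bool" where
  "resolves_z h l x y z w \<zeta> \<longleftrightarrow>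
     (\<exists>N V. open N \<and> (x, y, z) \<in> N \<and> open V \<and> w \<in> V \<and>
        smooth_on N (\<lambda>(x', y', z'). \<zeta> x' y' z') \<and>
        (\<forall>(x', y', z')\<in>N. \<zeta> x' y' z' \<in> V \<and>
           (\<forall>w'\<in>V. z_rel h l x' y' z' w' \<longleftrightarrow> w' = \<zeta> x' y' z')))"

text \<open>In the Jacobian of the last clause, \<open>z\<^sub>j\<^sub>+\<^sub>1\<close> is regarded as the function \<open>\<zeta>\<close> of \<open>x\<^sub>j\<^sub>+\<^sub>1\<close>.\<close>

definition sufficiently_small_step ::
    "('q, 'n::finite) chart set \<Rightarrow> ('q \<Rightarrow> 'q \<Rightarrow> real \<Rightarrow> real \<Rightarrow> real) \<Rightarrow> real \<Rightarrow> bool" where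
  "sufficiently_small_step A L h \<longleftrightarrow>
     (\<forall>c\<in>A. \<forall>d\<in>A. \<forall>x\<in>img c. \<forall>y\<in>img d. \<forall>z w.
        z_rel h (in_charts L c d) x y z w \<longrightarrow>
          1 - h * D4 (in_charts L c d) x y z w \<noteq> 0 \<and>
          1 + h * D3 (in_charts L c d) x y z w \<noteq> 0 \<and>
          (\<exists>\<zeta>. resolves_z h (in_charts L c d) x y z w \<zeta>)) \<and>
     (\<forall>c0\<in>A. \<forall>c1\<in>A. \<forall>c2\<in>A. \<forall>x0\<in>img c0. \<forall>x1\<in>img c1. \<forall>x2\<in>img c2. \<forall>z0 z1 z2 \<zeta>.
        dgel_solution h (in_charts L c0 c1) (in_charts L c1 c2) x0 x1 x2 z0 z1 z2 \<longrightarrow>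
        resolves_z h (in_charts L c1 c2) x1 x2 z1 z2 \<zeta> \<longrightarrow>
          det (jacobian (\<lambda>y. dgel_lhs h (in_charts L c0 c1) (in_charts L c1 c2)
                               x0 x1 y z0 z1 (\<zeta> x1 y z1)) (at x2)) \<noteq> 0)"


section \<open>Momenta and the discrete Legendre transforms\<close>

definition p_minus ::
    "real \<Rightarrow> 'n::finite coord_lagrangian \<Rightarrow> real^'n \<Rightarrow> real^'n \<Rightarrow> real \<Rightarrow> real \<Rightarrow> real^'n" where
  "p_minus h l x y z w = (h / (1 - h * D4 l x y z w)) *\<^sub>R D2 l x y z w"

definition p_plus ::
    "real \<Rightarrow> 'n::finite coord_lagrangian \<Rightarrow> real^'n \<Rightarrow> real^'n \<Rightarrow> real \<Rightarrow> real \<Rightarrow> real^'n" where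
  "p_plus h l x y z w = - ((h / (1 + h * D3 l x y z w)) *\<^sub>R D1 l x y z w)"

text \<open>Passage from \<open>Q\<^sup>2 \<times> \<real>\<close> to the induced coordinates \<open>(x, p, z)\<close> of \<open>T\<^sup>*Q \<times> \<real>\<close>, at the first
  point (with \<open>p\<^sup>+\<close>) and at the second point (with \<open>p\<^sup>-\<close>) of a discrete step.\<close>

definition leg_plus ::
    "real \<Rightarrow> 'n::finite coord_lagrangian \<Rightarrow> (real^'n \<Rightarrow> real^'n \<Rightarrow> real \<Rightarrow> real)
       \<Rightarrow> (real^'n) \<times> (real^'n) \<times> real \<Rightarrow> (real^'n) \<times> (real^'n) \<times> real" where
  "leg_plus h l \<zeta> = (\<lambda>(x, y, z). (x, p_plus h l x y z (\<zeta> x y z), z))"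

definition leg_minus ::
    "real \<Rightarrow> 'n::finite coord_lagrangian \<Rightarrow> (real^'n \<Rightarrow> real^'n \<Rightarrow> real \<Rightarrow> real)
       \<Rightarrow> (real^'n) \<times> (real^'n) \<times> real \<Rightarrow> (real^'n) \<times> (real^'n) \<times> real" where
  "leg_minus h l \<zeta> = (\<lambda>(x, y, z). (y, p_minus h l x y z (\<zeta> x y z), \<zeta> x y z))"

text \<open>The equation \<open>p = p\<^sup>+(x, y, z)\<close> can be solved for \<open>y\<close> by the implicit function theorem.
  This delimits where a map \<open>(x\<^sub>j\<^sub>-\<^sub>1, p\<^sub>j\<^sub>-\<^sub>1, z\<^sub>j\<^sub>-\<^sub>1) \<mapsto> (x\<^sub>j, p\<^sub>j, z\<^sub>j)\<close> is defined. If \<open>x\<^sub>j\<^sub>-\<^sub>1\<close> has a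
  predecessor \<open>x\<^sub>j\<^sub>-\<^sub>2\<close>, so that \<open>p\<^sub>j\<^sub>-\<^sub>1 = p\<^sub>j\<^sub>-\<^sub>1\<^sup>- = p\<^sub>j\<^sub>-\<^sub>1\<^sup>+\<close>, then it follows from the Jacobian condition in
  \<open>sufficiently_small_step\<close>, because \<open>dgel_lhs = ((1 + h D\<^sub>3 k) / h) (p\<^sup>- - p\<^sup>+)\<close>. That condition does not
  constrain initial points without a predecessor, where it has to be required separately.\<close>

definition p_plus_solvable ::
    "real \<Rightarrow> 'n::finite coord_lagrangian \<Rightarrow> (real^'n \<Rightarrow> real^'n \<Rightarrow> real \<Rightarrow> real)
       \<Rightarrow> real^'n \<Rightarrow> real^'n \<Rightarrow> real \<Rightarrow> bool" where
  "p_plus_solvable h l \<zeta> x y z \<longleftrightarrow>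
     det (jacobian (\<lambda>y'. p_plus h l x y' z (\<zeta> x y' z)) (at y)) \<noteq> 0"


section \<open>Contact transformations\<close>

text \<open>The 1-form \<open>dz - p dx\<close> at \<open>(x, p, z)\<close>, evaluated on the tangent vector \<open>(dx, dp, dz)\<close>.\<close>

definition contact_form ::
    "(real^'n::finite) \<times> (real^'n) \<times> real \<Rightarrow> (real^'n) \<times> (real^'n) \<times> real \<Rightarrow> real" where
  "contact_form = (\<lambda>(x, p, z) (dx, dp, dz). dz - (\<Sum>i\<in>UNIV. p $ i * dx $ i))"

definition pullback ::
    "('a::real_normed_vector \<Rightarrow> 'b::real_normed_vector) \<Rightarrow> ('b \<Rightarrow> 'b \<Rightarrow> real) \<Rightarrow> 'a \<Rightarrow> 'a \<Rightarrow> real" where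
  "pullback F \<omega> m v = \<omega> (F m) (frechet_derivative F (at m) v)"

definition contact_transformation_on ::
    "((real^'n::finite) \<times> (real^'n) \<times> real) set
       \<Rightarrow> ((real^'n) \<times> (real^'n) \<times> real \<Rightarrow> (real^'n) \<times> (real^'n) \<times> real) \<Rightarrow> bool" where
  "contact_transformation_on W F \<longleftrightarrow>
     smooth_on W F \<and>
     (\<exists>f. \<forall>m\<in>W. f m \<noteq> 0 \<and> (\<forall>v. pullback F contact_form m v = f m * contact_form m v))"

end

theory Submission
  imports Defs
begin

text \<open>
  The left-hand side of the discrete Euler-Lagrange equations equals \<open>((1 + h D\<^sub>3 L) / h) (p\<^sup>- - p\<^sup>+)\<close>,
  so they say that the Legendre transforms of two consecutive steps agree. By the inverse function
  theorem both \<open>leg_plus\<close> are local diffeomorphisms: the one of the second step yields the flow \<open>\<Phi>\<close> as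
  \<open>leg_plus\<^sup>-\<^sup>1 \<circ> leg_minus\<close>, and the one of the first step yields \<open>F = leg_minus \<circ> leg_plus\<^sup>-\<^sup>1\<close>.
  Differentiating \<open>z\<^sub>1 - z\<^sub>0 = h L\<close> gives
  \<open>(1 - h D\<^sub>4 L) (dz\<^sub>1 - p\<^sup>- dx\<^sub>1) = (1 + h D\<^sub>3 L) (dz\<^sub>0 - p\<^sup>+ dx\<^sub>0)\<close>, so \<open>F\<close> is a contact transformation
  with conformal factor \<open>(1 + h D\<^sub>3 L) / (1 - h D\<^sub>4 L)\<close>.
\<close>

section \<open>Calculus of smooth maps\<close>

text \<open>\<open>frechet_derivative\<close> is a choice among all derivatives at \<open>x\<close>.
  The two maps have the same derivatives there, so the choice agrees even where neither map is
  differentiable.\<close>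

lemma frechet_derivative_cong_open:
  assumes "open S" "x \<in> S" "\<And>y. y \<in> S \<Longrightarrow> f y = g y"
  shows "frechet_derivative f (at x) = frechet_derivative g (at x)"
proof -
  have "(f has_derivative D) (at x) \<longleftrightarrow> (g has_derivative D) (at x)" for D
    using assms by (auto elim!: has_derivative_transform_within_open)
  then show ?thesis by (simp add: frechet_derivative_def)
qed

lemma Ck_on_cong:
  assumes "open S" "\<And>x. x \<in> S \<Longrightarrow> f x = g x" "Ck_on k S f"
  shows "Ck_on k S g"
  using assms(2,3)
proof (induction k arbitrary: f g)
  case 0
  then show ?case by (simp cong: continuous_on_cong)
next
  case (Suc k)
  have "g differentiable_on S"
    using Suc.prems by (auto simp: differentiable_on_def
        intro!: differentiable_transform_within[OF _ zero_less_one, of f _ S g])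
  moreover have "Ck_on k S (\<lambda>x. frechet_derivative g (at x) v)" for v
  proof (rule Suc.IH)
    show "Ck_on k S (\<lambda>x. frechet_derivative f (at x) v)" using Suc.prems(2) by simp
    show "frechet_derivative f (at x) v = frechet_derivative g (at x) v" if "x \<in> S" for x
      by (simp add: frechet_derivative_cong_open[OF assms(1) that, of f g] Suc.prems(1))
  qed
  ultimately show ?case by simp
qed

lemma Ck_on_subset: "Ck_on k S f \<Longrightarrow> T \<subseteq> S \<Longrightarrow> Ck_on k T f"
proof (induction k arbitrary: f)
  case 0
  then show ?case by (auto intro: continuous_on_subset)
next
  case (Suc k)
  then show ?case by (auto intro: differentiable_on_subset)
qed

text \<open>\<open>Ck_on\<close> refers to the chosen \<open>frechet_derivative\<close>. Uniqueness
  of derivatives lets any family \<open>f'\<close> found by a differentiation rule take its place,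
  which is how the closure properties below are proved.\<close>

lemma Ck_on_SucI:
  assumes "open S" "\<And>x. x \<in> S \<Longrightarrow> (f has_derivative f' x) (at x)"
    "\<And>v. Ck_on k S (\<lambda>x. f' x v)"
  shows "Ck_on (Suc k) S f"
proof -
  have "f' x v = frechet_derivative f (at x) v" if "x \<in> S" for x v
    by (metis assms(2)[OF that] frechet_derivative_at)
  then have "Ck_on k S (\<lambda>x. frechet_derivative f (at x) v)" for v
    using assms(3) by (rule Ck_on_cong[OF assms(1)])
  moreover have "f differentiable_on S"
    using assms(2) by (auto simp: differentiable_on_def intro: differentiableI has_derivative_at_withinI)
  ultimately show ?thesis by simp
qed

lemma Ck_on_has_derivative:
  assumes "open S" "Ck_on (Suc k) S f" "x \<in> S"
  shows "(f has_derivative frechet_derivative f (at x)) (at x)"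
  using assms by (auto simp: differentiable_on_eq_differentiable_at frechet_derivative_works)

lemma Ck_on_imp_continuous_on: "Ck_on k S f \<Longrightarrow> continuous_on S f"
  by (cases k) (auto intro: differentiable_imp_continuous_on)

lemma Ck_on_Suc_imp: "Ck_on (Suc k) S f \<Longrightarrow> Ck_on k S f"
  by (induction k arbitrary: f) (auto intro: differentiable_imp_continuous_on)

lemma Ck_on_const: "open S \<Longrightarrow> Ck_on k S (\<lambda>x. c)"
proof (induction k arbitrary: c)
  case (Suc k)
  then show ?case by (intro Ck_on_SucI[where f' = "\<lambda>x v. 0"]) auto
qed auto

lemma Ck_on_ident: "open S \<Longrightarrow> Ck_on k S (\<lambda>x. x)"
proof (induction k)
  case (Suc k)
  then show ?case by (intro Ck_on_SucI[where f' = "\<lambda>x v. v"]) (auto intro: Ck_on_const)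
qed auto

lemma Ck_on_bounded_linear:
  assumes "open S" "bounded_linear T" "Ck_on k S f"
  shows "Ck_on k S (\<lambda>x. T (f x))"
  using assms(3)
proof (induction k arbitrary: f)
  case 0
  then show ?case using bounded_linear.continuous_on[OF assms(2)] by simp
next
  case (Suc k)
  show ?case
  proof (rule Ck_on_SucI[OF assms(1)])
    show "((\<lambda>x. T (f x)) has_derivative (\<lambda>v. T (frechet_derivative f (at x) v))) (at x)" if "x \<in> S" for x
      using bounded_linear.has_derivative[OF assms(2) Ck_on_has_derivative[OF assms(1) Suc.prems that]] .
    show "Ck_on k S (\<lambda>x. T (frechet_derivative f (at x) v))" for v
      using Suc by simp
  qed
qed

lemma Ck_on_add:
  assumes "open S" "Ck_on k S f" "Ck_on k S g"
  shows "Ck_on k S (\<lambda>x. f x + g x)"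
  using assms(2,3)
proof (induction k arbitrary: f g)
  case 0
  then show ?case by (auto intro: continuous_intros)
next
  case (Suc k)
  show ?case
  proof (rule Ck_on_SucI[OF assms(1)])
    show "((\<lambda>x. f x + g x) has_derivative
      (\<lambda>v. frechet_derivative f (at x) v + frechet_derivative g (at x) v)) (at x)" if "x \<in> S" for x
      by (rule has_derivative_add[OF Ck_on_has_derivative[OF assms(1) Suc.prems(1) that]
            Ck_on_has_derivative[OF assms(1) Suc.prems(2) that]])
    show "Ck_on k S (\<lambda>x. frechet_derivative f (at x) v + frechet_derivative g (at x) v)" for v
      using Suc by simp
  qed
qed

lemma Ck_on_Pair:
  assumes "open S" "Ck_on k S f" "Ck_on k S g"
  shows "Ck_on k S (\<lambda>x. (f x, g x))"
  using assms(2,3)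
proof (induction k arbitrary: f g)
  case 0
  then show ?case by (auto intro: continuous_intros)
next
  case (Suc k)
  show ?case
  proof (rule Ck_on_SucI[OF assms(1)])
    show "((\<lambda>x. (f x, g x)) has_derivative
      (\<lambda>v. (frechet_derivative f (at x) v, frechet_derivative g (at x) v))) (at x)" if "x \<in> S" for x
      by (rule has_derivative_Pair[OF Ck_on_has_derivative[OF assms(1) Suc.prems(1) that]
            Ck_on_has_derivative[OF assms(1) Suc.prems(2) that]])
    show "Ck_on k S (\<lambda>x. (frechet_derivative f (at x) v, frechet_derivative g (at x) v))" for v
      using Suc by simp
  qed
qed

text \<open>Each summand of the product rule pairs one factor with the derivative of the other. The
  induction therefore runs over both factors, and the undifferentiated one is lowered to class
  \<open>C^k\<close>.\<close>

lemma Ck_on_scaleR: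
  fixes f :: "_ \<Rightarrow> real"
  assumes "open S" "Ck_on k S f" "Ck_on k S g"
  shows "Ck_on k S (\<lambda>x. f x *\<^sub>R g x)"
  using assms(2,3)
proof (induction k arbitrary: f g)
  case 0
  then show ?case by (auto intro: continuous_intros)
next
  case (Suc k)
  show ?case
  proof (rule Ck_on_SucI[OF assms(1)])
    show "((\<lambda>x. f x *\<^sub>R g x) has_derivative
      (\<lambda>v. f x *\<^sub>R frechet_derivative g (at x) v + frechet_derivative f (at x) v *\<^sub>R g x)) (at x)"
      if "x \<in> S" for x
      by (rule has_derivative_scaleR[OF Ck_on_has_derivative[OF assms(1) Suc.prems(1) that]
            Ck_on_has_derivative[OF assms(1) Suc.prems(2) that]])
    show "Ck_on k S (\<lambda>x. f x *\<^sub>R frechet_derivative g (at x) v + frechet_derivative f (at x) v *\<^sub>R g x)" for v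
      using Suc.prems by (intro Ck_on_add[OF assms(1)] Suc.IH) (auto dest: Ck_on_Suc_imp simp del: Ck_on.simps(2), auto)
  qed
qed

lemma Ck_on_sum:
  assumes "open S" "\<And>i. i \<in> I \<Longrightarrow> Ck_on k S (f i)"
  shows "Ck_on k S (\<lambda>x. \<Sum>i\<in>I. f i x)"
  using assms(2)
  by (induction I rule: infinite_finite_induct) (auto intro: Ck_on_add Ck_on_const assms(1))

lemma linear_euclidean_expansion:
  fixes T :: "'a::euclidean_space \<Rightarrow> 'b::real_vector"
  assumes "linear T"
  shows "T v = (\<Sum>b\<in>Basis. (v \<bullet> b) *\<^sub>R T b)"
proof -
  have "T v = T (\<Sum>b\<in>Basis. (v \<bullet> b) *\<^sub>R b)" by (simp add: euclidean_representation)
  then show ?thesis by (simp add: linear_sum[OF assms] linear_scale[OF assms])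
qed

text \<open>Expanding \<open>w x\<close> in the basis leaves only the maps \<open>a x b\<close> with
  constant \<open>b\<close>, multiplied by scalar coefficients of class \<open>C^k\<close>.\<close>

lemma Ck_on_apply_linear:
  fixes a :: "'b::euclidean_space \<Rightarrow> 'a::euclidean_space \<Rightarrow> 'c::real_normed_vector"
  assumes S: "open S" and "\<And>x. x \<in> S \<Longrightarrow> linear (a x)"
    and a: "\<And>v. Ck_on k S (\<lambda>x. a x v)" and w: "Ck_on k S w"
  shows "Ck_on k S (\<lambda>x. a x (w x))"
proof (rule Ck_on_cong[OF S])
  show "(\<Sum>b\<in>Basis. (w x \<bullet> b) *\<^sub>R a x b) = a x (w x)" if "x \<in> S" for x
    using linear_euclidean_expansion[OF assms(2)[OF that], of "w x"] by simp
  show "Ck_on k S (\<lambda>x. \<Sum>b\<in>Basis. (w x \<bullet> b) *\<^sub>R a x b)"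
    by (intro Ck_on_sum Ck_on_scaleR S a Ck_on_bounded_linear[OF S bounded_linear_inner_left w])
qed

text \<open>In the chain rule the derivative of \<open>g\<close> at \<open>f x\<close> acts on a
  vector that depends on \<open>x\<close>. \<open>Ck_on_apply_linear\<close> separates the two
  dependences: in a fixed direction \<open>u\<close> the derivative of \<open>g\<close> is a map of
  class \<open>C^k\<close> on \<open>T\<close>, and the induction hypothesis covers its composition
  with \<open>f\<close>.\<close>

lemma Ck_on_compose:
  fixes f :: "'a::euclidean_space \<Rightarrow> 'b::euclidean_space" and g :: "'b \<Rightarrow> 'c::real_normed_vector"
  assumes S: "open S" and T: "open T" and "f ` S \<subseteq> T" and "Ck_on k S f" "Ck_on k T g"
  shows "Ck_on k S (\<lambda>x. g (f x))"
  using assms(3-5)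
proof (induction k arbitrary: g)
  case 0
  then show ?case by (auto intro: continuous_on_compose2)
next
  case (Suc k)
  show ?case
  proof (rule Ck_on_SucI[OF S])
    have dg: "(g has_derivative frechet_derivative g (at (f x))) (at (f x))" if "x \<in> S" for x
      using that Suc.prems by (intro Ck_on_has_derivative[OF T]) auto
    show "((\<lambda>x. g (f x)) has_derivative
      (\<lambda>v. frechet_derivative g (at (f x)) (frechet_derivative f (at x) v))) (at x)"
      if "x \<in> S" for x
      using diff_chain_at[OF Ck_on_has_derivative[OF S Suc.prems(2) that] dg[OF that]]
      by (simp add: o_def)
    show "Ck_on k S (\<lambda>x. frechet_derivative g (at (f x)) (frechet_derivative f (at x) v))" for v
    proof (rule Ck_on_apply_linear[OF S])
      show "linear (frechet_derivative g (at (f x)))" if "x \<in> S" for x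
        using dg[OF that] has_derivative_linear by blast
      show "Ck_on k S (\<lambda>x. frechet_derivative g (at (f x)) u)" for u
        using Suc.prems by (intro Suc.IH[of "\<lambda>y. frechet_derivative g (at y) u"])
          (auto dest: Ck_on_Suc_imp simp del: Ck_on.simps(2), auto)
      show "Ck_on k S (\<lambda>x. frechet_derivative f (at x) v)" using Suc.prems by simp
    qed
  qed
qed

section \<open>Linear systems whose coefficients depend on a parameter\<close>

text \<open>A linear injection in finite dimension has a lower bound \<open>B\<close>. The operator
  norm of \<open>a y - a x\<close> is at most the sum of its norms on the basis, which is continuous
  in \<open>y\<close> and vanishes at \<open>x\<close>, so half of the bound survives near
  \<open>x\<close>.\<close>

lemma linear_family_bounded_below:
  fixes a :: "'b::metric_space \<Rightarrow> 'a::euclidean_space \<Rightarrow> 'c::euclidean_space"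
  assumes "open S" "x \<in> S" and lin: "\<And>y. y \<in> S \<Longrightarrow> linear (a y)" and "inj (a x)"
    and cont: "\<And>v. continuous_on S (\<lambda>y. a y v)"
  obtains m where "m > 0" "\<forall>\<^sub>F y in nhds x. \<forall>u. m * norm u \<le> norm (a y u)"
proof -
  obtain B where B: "B > 0" "\<And>u. B * norm u \<le> norm (a x u)"
    using linear_inj_bounded_below_pos[OF lin[OF assms(2)] assms(4)] by metis
  have "isCont (\<lambda>y. \<Sum>b\<in>Basis. norm (a y b - a x b)) x"
    using cont assms(1,2) by (auto intro!: continuous_intros simp: continuous_on_eq_continuous_at)
  then have "((\<lambda>y. \<Sum>b\<in>Basis. norm (a y b - a x b)) \<longlongrightarrow> 0) (nhds x)"
    by (simp add: continuous_at isCont_def tendsto_nhds_iff)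
  then have "\<forall>\<^sub>F y in nhds x. (\<Sum>b\<in>Basis. norm (a y b - a x b)) < B / 2"
    using B(1) by (intro order_tendstoD(2)[of _ 0]) auto
  moreover have "\<forall>\<^sub>F y in nhds x. y \<in> S" using assms(1,2) by (rule eventually_nhds_in_open)
  ultimately have "\<forall>\<^sub>F y in nhds x. \<forall>u. B / 2 * norm u \<le> norm (a y u)"
  proof eventually_elim
    case (elim y)
    show ?case
    proof
      fix u
      have "a y u - a x u = (\<Sum>b\<in>Basis. (u \<bullet> b) *\<^sub>R (a y b - a x b))"
        using linear_euclidean_expansion[OF lin[OF elim(2)], of u]
          linear_euclidean_expansion[OF lin[OF assms(2)], of u]
        by (simp add: scaleR_diff_right sum_subtractf)
      also have "norm \<dots> \<le> (\<Sum>b\<in>Basis. norm u * norm (a y b - a x b))"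
        by (rule sum_norm_le) (auto intro!: mult_right_mono Basis_le_norm)
      also have "\<dots> \<le> norm u * (B / 2)"
        unfolding sum_distrib_left[symmetric] using elim(1) by (intro mult_left_mono) auto
      finally have "norm (a y u - a x u) \<le> norm u * (B / 2)" .
      then show "B / 2 * norm u \<le> norm (a y u)"
        using B(2)[of u] norm_triangle_ineq2[of "a x u" "a y u"]
        by (simp add: norm_minus_commute algebra_simps)
    qed
  qed
  then show ?thesis using that[of "B / 2"] B(1) by simp
qed


text \<open>This is the product rule for a linear map acting on a vector. After expansion in the
  basis, the variation of \<open>a\<close> enters only through its values on basis vectors.\<close>

lemma has_derivative_apply_linear:
  fixes a :: "'b::real_normed_vector \<Rightarrow> 'a::euclidean_space \<Rightarrow> 'c::real_normed_vector"
  assumes "open S" "x \<in> S" and lin: "\<And>y. y \<in> S \<Longrightarrow> linear (a y)"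
    and da: "\<And>b. ((\<lambda>y. a y b) has_derivative a' b) (at x)"
    and du: "(u has_derivative u') (at x)"
  shows "((\<lambda>y. a y (u y)) has_derivative
    (\<lambda>h. a x (u' h) + (\<Sum>b\<in>Basis. (u x \<bullet> b) *\<^sub>R a' b h))) (at x)"
proof -
  have "((\<lambda>y. \<Sum>b\<in>Basis. (u y \<bullet> b) *\<^sub>R a y b) has_derivative
    (\<lambda>h. \<Sum>b\<in>Basis. (u x \<bullet> b) *\<^sub>R a' b h + (u' h \<bullet> b) *\<^sub>R a x b)) (at x)"
    by (intro has_derivative_sum has_derivative_scaleR da has_derivative_inner_left du)
  moreover have "(\<Sum>b\<in>Basis. (u x \<bullet> b) *\<^sub>R a' b h + (u' h \<bullet> b) *\<^sub>R a x b) =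
      a x (u' h) + (\<Sum>b\<in>Basis. (u x \<bullet> b) *\<^sub>R a' b h)" for h
    using linear_euclidean_expansion[OF lin[OF assms(2)], of "u' h"] by (simp add: sum.distrib)
  ultimately have "((\<lambda>y. \<Sum>b\<in>Basis. (u y \<bullet> b) *\<^sub>R a y b) has_derivative
    (\<lambda>h. a x (u' h) + (\<Sum>b\<in>Basis. (u x \<bullet> b) *\<^sub>R a' b h))) (at x)"
    by simp
  then show ?thesis
    by (rule has_derivative_transform_within_open[OF _ assms(1,2)])
      (metis linear_euclidean_expansion lin)
qed

text \<open>Linearity gives \<open>a y (w y - w x) = v y - a y (w x)\<close>, and the right-hand
  side tends to \<open>v x - a x (w x) = 0\<close>. The lower bound on \<open>a y\<close>, uniform
  near \<open>x\<close>, carries this over to \<open>w y - w x\<close>.\<close>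

lemma continuous_on_solve_linear:
  fixes a :: "'b::metric_space \<Rightarrow> 'a::euclidean_space \<Rightarrow> 'a"
  assumes S: "open S" and lin: "\<And>x. x \<in> S \<Longrightarrow> linear (a x)" and inj: "\<And>x. x \<in> S \<Longrightarrow> inj (a x)"
    and a: "\<And>u. continuous_on S (\<lambda>x. a x u)" and v: "continuous_on S v"
    and eq: "\<And>x. x \<in> S \<Longrightarrow> a x (w x) = v x"
  shows "continuous_on S w"
proof -
  have "(w \<longlongrightarrow> w x) (at x)" if x: "x \<in> S" for x
  proof -
    obtain m where m: "m > 0" "\<forall>\<^sub>F y in nhds x. \<forall>u. m * norm u \<le> norm (a y u)"
      using linear_family_bounded_below[OF S x lin inj[OF x] a] by metis
    have "isCont (\<lambda>y. norm (v y - a y (w x)) / m) x"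
      using a v S x m(1) by (auto intro!: continuous_intros simp: continuous_on_eq_continuous_at)
    then have lim: "((\<lambda>y. norm (v y - a y (w x)) / m) \<longlongrightarrow> 0) (at x)"
      by (simp add: isCont_def eq[OF x])
    have "\<forall>\<^sub>F y in nhds x. norm (w y - w x) \<le> norm (v y - a y (w x)) / m"
      using m(2) eventually_nhds_in_open[OF S x]
    proof eventually_elim
      case (elim y)
      have "m * norm (w y - w x) \<le> norm (a y (w y - w x))" using elim(1) by blast
      also have "a y (w y - w x) = v y - a y (w x)"
        using elim(2) by (simp add: linear_diff[OF lin] eq)
      finally show ?case using m(1) by (simp add: field_simps)
    qed
    then have "\<forall>\<^sub>F y in at x. norm (w y - w x) \<le> norm (v y - a y (w x)) / m"
      by (auto simp: eventually_at_filter elim: eventually_mono)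
    then have "((\<lambda>y. w y - w x) \<longlongrightarrow> 0) (at x)"
      using lim by (rule Lim_null_comparison)
    then show ?thesis by (simp add: LIM_zero_iff)
  qed
  then show ?thesis by (simp add: continuous_on_eq_continuous_at[OF S] isCont_def)
qed

text \<open>Formal differentiation of \<open>a y (w y) = v y\<close> gives
  \<open>a x (w' h) = R h\<close>, and inverting \<open>a x\<close> yields the candidate
  \<open>w'\<close>. That it is the derivative then follows from the equation for \<open>w\<close>,
  without presupposing that \<open>w\<close> is differentiable.\<close>

lemma has_derivative_solve_linear:
  fixes a :: "'b::real_normed_vector \<Rightarrow> 'a::euclidean_space \<Rightarrow> 'a"
  assumes S: "open S" and x: "x \<in> S" and lin: "\<And>y. y \<in> S \<Longrightarrow> linear (a y)" and inj: "inj (a x)"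
    and a: "\<And>u. continuous_on S (\<lambda>y. a y u)" and eq: "\<And>y. y \<in> S \<Longrightarrow> a y (w y) = v y"
    and da: "\<And>b. ((\<lambda>y. a y b) has_derivative a' b) (at x)"
    and dv: "(v has_derivative v') (at x)"
  obtains w' where "(w has_derivative w') (at x)"
    "\<And>h. a x (w' h) = v' h - (\<Sum>b\<in>Basis. (w x \<bullet> b) *\<^sub>R a' b h)"
proof -
  define R where "R h = v' h - (\<Sum>b\<in>Basis. (w x \<bullet> b) *\<^sub>R a' b h)" for h
  have R: "bounded_linear R"
    unfolding R_def using da dv
    by (intro bounded_linear_sub bounded_linear_sum bounded_linear_const_scaleR has_derivative_bounded_linear)
  obtain ai where ai: "linear ai" "\<And>u. ai (a x u) = u" "\<And>u. a x (ai u) = u"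
    using linear_injective_isomorphism[OF lin[OF x] inj] by metis
  define w' where "w' h = ai (R h)" for h
  have w': "bounded_linear w'"
    unfolding w'_def using bounded_linear_compose[OF _ R] ai(1) linear_conv_bounded_linear by blast
  have aw': "a x (w' h) = R h" for h by (simp add: w'_def ai)
  obtain m where m: "m > 0" "\<forall>\<^sub>F y in nhds x. \<forall>u. m * norm u \<le> norm (a y u)"
    using linear_family_bounded_below[OF S x lin inj a] by metis
  \<comment> \<open>Since \<open>a y (w y - w x - w' (y - x)) = \<psi> y\<close>, the bound below for \<open>a y\<close> reduces the claim to \<open>\<psi>' = 0\<close>.\<close>
  define \<psi> where "\<psi> y = v y - a y (w x + w' (y - x))" for y
  \<comment> \<open>The product rule for the subtracted term of \<open>\<psi>\<close> contributes
    \<open>a x (w' h)\<close> and the sum over the basis. By the choice of \<open>R\<close> these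
    add up to \<open>v' h\<close>, so the derivative of \<open>\<psi>\<close> is zero.\<close>
  have "((\<lambda>y. w x + w' (y - x)) has_derivative w') (at x)"
    by (auto intro!: derivative_eq_intros bounded_linear.has_derivative[OF w'])
  from has_derivative_diff[OF dv has_derivative_apply_linear[OF S x lin da this]]
  have "(\<psi> has_derivative (\<lambda>h. 0)) (at x)"
    by (simp add: \<psi>_def[abs_def] aw' R_def linear_0[OF bounded_linear.linear[OF w']])
  moreover have "\<psi> x = 0"
    by (simp add: \<psi>_def eq[OF x] linear_0[OF bounded_linear.linear[OF w']])
  ultimately have "((\<lambda>y. norm (\<psi> y) / norm (y - x)) \<longlongrightarrow> 0) (at x)"
    by (simp add: has_derivative_iff_norm)
  then have lim: "((\<lambda>y. norm (\<psi> y) / norm (y - x) / m) \<longlongrightarrow> 0) (at x)"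
    using tendsto_divide[OF _ tendsto_const, of _ 0 "at x" m] m(1) by force
  have "\<forall>\<^sub>F y in nhds x. norm (w y - w x - w' (y - x)) \<le> norm (\<psi> y) / m"
    using m(2) eventually_nhds_in_open[OF S x]
  proof eventually_elim
    case (elim y)
    have "m * norm (w y - w x - w' (y - x)) \<le> norm (a y (w y - w x - w' (y - x)))"
      using elim(1) by blast
    also have "a y (w y - w x - w' (y - x)) = \<psi> y"
      using elim(2) by (simp add: linear_diff[OF lin] linear_add[OF lin] eq \<psi>_def)
    finally show ?case using m(1) by (simp add: field_simps)
  qed
  then have "\<forall>\<^sub>F y in at x. norm (w y - w x - w' (y - x)) \<le> norm (\<psi> y) / m"
    by (auto simp: eventually_at_filter elim: eventually_mono)
  then have "\<forall>\<^sub>F y in at x. norm (norm (w y - w x - w' (y - x)) / norm (y - x)) \<le> norm (\<psi> y) / norm (y - x) / m"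
  proof (rule eventually_mono)
    fix y
    assume "norm (w y - w x - w' (y - x)) \<le> norm (\<psi> y) / m"
    from divide_right_mono[OF this, of "norm (y - x)"]
    show "norm (norm (w y - w x - w' (y - x)) / norm (y - x)) \<le> norm (\<psi> y) / norm (y - x) / m"
      by (simp add: mult.commute)
  qed
  then have "((\<lambda>y. norm (w y - w x - w' (y - x)) / norm (y - x)) \<longlongrightarrow> 0) (at x)"
    using lim by (rule Lim_null_comparison)
  then have "(w has_derivative w') (at x)" using w' by (simp add: has_derivative_iff_norm)
  then show ?thesis using that aw' by (simp add: R_def)
qed

text \<open>Differentiating \<open>a x (w x) = v x\<close> shows that \<open>w'\<close> solves the same linear system with a right-hand
  side one degree less smooth, so the induction runs over all right-hand sides at once.\<close>

lemma Ck_on_solve_linear: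
  fixes a :: "'b::euclidean_space \<Rightarrow> 'a::euclidean_space \<Rightarrow> 'a"
  assumes S: "open S" and lin: "\<And>x. x \<in> S \<Longrightarrow> linear (a x)" and inj: "\<And>x. x \<in> S \<Longrightarrow> inj (a x)"
    and "\<And>u. Ck_on k S (\<lambda>x. a x u)" "Ck_on k S v" "\<And>x. x \<in> S \<Longrightarrow> a x (w x) = v x"
  shows "Ck_on k S w"
  using assms(4-6)
proof (induction k arbitrary: v w)
  case 0
  then show ?case using continuous_on_solve_linear[OF S lin inj, where v = v and w = w] by simp
next
  case (Suc k)
  define a' where "a' x b = frechet_derivative (\<lambda>y. a y b) (at x)" for x b
  define v' where "v' x = frechet_derivative v (at x)" for x
  have da: "((\<lambda>y. a y b) has_derivative a' x b) (at x)" if "x \<in> S" for x b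
    unfolding a'_def by (rule Ck_on_has_derivative[OF S Suc.prems(1) that])
  have dv: "(v has_derivative v' x) (at x)" if "x \<in> S" for x
    unfolding v'_def by (rule Ck_on_has_derivative[OF S Suc.prems(2) that])
  have "\<exists>w'. (w has_derivative w') (at x) \<and>
      (\<forall>h. a x (w' h) = v' x h - (\<Sum>b\<in>Basis. (w x \<bullet> b) *\<^sub>R a' x b h))" if "x \<in> S" for x
    using has_derivative_solve_linear[OF S that lin inj[OF that]
      Ck_on_imp_continuous_on[OF Suc.prems(1)] Suc.prems(3) da[OF that] dv[OF that]] by metis
  then obtain w' where w': "\<And>x. x \<in> S \<Longrightarrow> (w has_derivative w' x) (at x)"
    "\<And>x h. x \<in> S \<Longrightarrow> a x (w' x h) = v' x h - (\<Sum>b\<in>Basis. (w x \<bullet> b) *\<^sub>R a' x b h)"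
    by metis
  have ck: "Ck_on k S (\<lambda>x. a x u)" "Ck_on k S v" for u
    using Suc.prems(1,2) by (blast intro: Ck_on_Suc_imp)+
  \<comment> \<open>The induction hypothesis is used twice: here for \<open>w\<close>, which occurs
    in the right-hand side of the system for \<open>w'\<close>, and afterwards for \<open>w'\<close>
    itself.\<close>
  have w: "Ck_on k S w" using Suc.prems(3) by (rule Suc.IH[OF ck])
  have "Ck_on k S (\<lambda>x. v' x h + - (\<Sum>b\<in>Basis. (w x \<bullet> b) *\<^sub>R a' x b h))" for h
  proof (rule Ck_on_add[OF S _ Ck_on_bounded_linear[OF S bounded_linear_minus[OF bounded_linear_ident]]])
    show "Ck_on k S (\<lambda>x. v' x h)" using Suc.prems(2) by (simp add: v'_def)
    have "Ck_on k S (\<lambda>x. a' x b h)" for b using Suc.prems(1)[of b] by (simp add: a'_def)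
    then show "Ck_on k S (\<lambda>x. \<Sum>b\<in>Basis. (w x \<bullet> b) *\<^sub>R a' x b h)"
      by (rule Ck_on_sum[OF S Ck_on_scaleR[OF S Ck_on_bounded_linear[OF S bounded_linear_inner_left w]]])
  qed
  then have "Ck_on k S (\<lambda>x. w' x h)" for h
  proof (rule Suc.IH[OF ck(1)])
    show "a x (w' x h) = v' x h + - (\<Sum>b\<in>Basis. (w x \<bullet> b) *\<^sub>R a' x b h)" if "x \<in> S" for x
      by (simp only: w'(2)[OF that] diff_conv_add_uminus)
  qed
  with w'(1) show ?case by (rule Ck_on_SucI[OF S])
qed

section \<open>Passage from class \<open>C^k\<close> to smooth maps\<close>

lemma smooth_on_has_derivative:
  assumes "open S" "smooth_on S f" "x \<in> S"
  shows "(f has_derivative frechet_derivative f (at x)) (at x)"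
  using assms Ck_on_has_derivative unfolding smooth_on_def by blast

lemma smooth_on_imp_continuous_on: "smooth_on S f \<Longrightarrow> continuous_on S f"
  unfolding smooth_on_def using Ck_on_imp_continuous_on by blast

lemma smooth_on_subset: "smooth_on S f \<Longrightarrow> T \<subseteq> S \<Longrightarrow> smooth_on T f"
  unfolding smooth_on_def using Ck_on_subset by blast

lemma smooth_on_cong:
  "open S \<Longrightarrow> (\<And>x. x \<in> S \<Longrightarrow> f x = g x) \<Longrightarrow> smooth_on S f \<Longrightarrow> smooth_on S g"
  unfolding smooth_on_def using Ck_on_cong by blast

lemma smooth_on_const: "open S \<Longrightarrow> smooth_on S (\<lambda>x. c)"
  unfolding smooth_on_def using Ck_on_const by blast

lemma smooth_on_bounded_linear:
  "open S \<Longrightarrow> bounded_linear T \<Longrightarrow> smooth_on S f \<Longrightarrow> smooth_on S (\<lambda>x. T (f x))"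
  unfolding smooth_on_def using Ck_on_bounded_linear by blast

lemma smooth_on_linear: "open S \<Longrightarrow> bounded_linear T \<Longrightarrow> smooth_on S T"
  unfolding smooth_on_def using Ck_on_bounded_linear[OF _ _ Ck_on_ident] by blast

lemma smooth_on_add:
  "open S \<Longrightarrow> smooth_on S f \<Longrightarrow> smooth_on S g \<Longrightarrow> smooth_on S (\<lambda>x. f x + g x)"
  unfolding smooth_on_def using Ck_on_add by blast

lemma smooth_on_Pair:
  "open S \<Longrightarrow> smooth_on S f \<Longrightarrow> smooth_on S g \<Longrightarrow> smooth_on S (\<lambda>x. (f x, g x))"
  unfolding smooth_on_def using Ck_on_Pair by blast

lemma smooth_on_scaleR:
  fixes f :: "_ \<Rightarrow> real"
  shows "open S \<Longrightarrow> smooth_on S f \<Longrightarrow> smooth_on S g \<Longrightarrow> smooth_on S (\<lambda>x. f x *\<^sub>R g x)"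
  unfolding smooth_on_def using Ck_on_scaleR by blast

lemma smooth_on_sum:
  "open S \<Longrightarrow> (\<And>i. i \<in> I \<Longrightarrow> smooth_on S (f i)) \<Longrightarrow> smooth_on S (\<lambda>x. \<Sum>i\<in>I. f i x)"
  unfolding smooth_on_def by (simp add: Ck_on_sum)

lemma smooth_on_compose:
  fixes f :: "'a::euclidean_space \<Rightarrow> 'b::euclidean_space" and g :: "'b \<Rightarrow> 'c::real_normed_vector"
  shows "open S \<Longrightarrow> open T \<Longrightarrow> f ` S \<subseteq> T \<Longrightarrow> smooth_on S f \<Longrightarrow> smooth_on T g \<Longrightarrow> smooth_on S (\<lambda>x. g (f x))"
  unfolding smooth_on_def using Ck_on_compose by blast

lemma smooth_on_frechet_derivative:
  "smooth_on S f \<Longrightarrow> smooth_on S (\<lambda>x. frechet_derivative f (at x) v)"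
  unfolding smooth_on_def using Ck_on.simps(2) by blast

text \<open>The reciprocal is the solution of the one-dimensional linear system with coefficient
  \<open>f x\<close> and right-hand side \<open>1\<close>, so \<open>Ck_on_solve_linear\<close>
  applies.\<close>

lemma smooth_on_inverse:
  fixes f :: "'a::euclidean_space \<Rightarrow> real"
  assumes "open S" "smooth_on S f" "\<And>x. x \<in> S \<Longrightarrow> f x \<noteq> 0"
  shows "smooth_on S (\<lambda>x. inverse (f x))"
  unfolding smooth_on_def
proof
  fix k
  show "Ck_on k S (\<lambda>x. inverse (f x))"
  proof (rule Ck_on_solve_linear[OF assms(1)])
    show "linear (\<lambda>u. f x *\<^sub>R u)" for x by (simp add: linear_iff algebra_simps)
    show "inj (\<lambda>u::real. f x *\<^sub>R u)" if "x \<in> S" for x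
      using assms(3)[OF that] by (auto simp: inj_def)
    show "Ck_on k S (\<lambda>x. f x *\<^sub>R u)" for u :: real
      using assms(2) unfolding smooth_on_def
      by (intro Ck_on_scaleR[OF assms(1)] Ck_on_const[OF assms(1)]) blast
    show "Ck_on k S (\<lambda>x. 1)" using assms(1) by (rule Ck_on_const)
    show "f x *\<^sub>R inverse (f x) = 1" if "x \<in> S" for x using assms(3)[OF that] by simp
  qed
qed

section \<open>The smooth inverse function theorem\<close>

text \<open>The inverse function theorem supplies a differentiable local inverse \<open>g\<close>,
  whose derivative solves the linear system with coefficients \<open>f'(g y)\<close> and constant
  right-hand side \<open>h\<close>. If \<open>g\<close> is of class \<open>C^k\<close>, so are the
  coefficients and hence the solution, and \<open>g\<close> is of class
  \<open>C^(k+1)\<close>.\<close>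

theorem smooth_inverse_function:
  fixes f :: "'a::euclidean_space \<Rightarrow> 'a"
  assumes U: "open U" and f: "smooth_on U f" and x0: "x0 \<in> U"
    and inj: "inj (frechet_derivative f (at x0))"
  obtains U' V g where "open U'" "U' \<subseteq> U" "x0 \<in> U'" "open V" "homeomorphism U' V f g" "smooth_on V g"
proof -
  \<comment> \<open>The derivative is packaged as a map into the bounded linear functions, where its
    continuity in operator norm can be stated. In finite dimension this reduces to continuity in
    each fixed direction.\<close>
  define f' where "f' x = Blinfun (frechet_derivative f (at x))" for x
  have f': "blinfun_apply (f' x) = frechet_derivative f (at x)" if "x \<in> U" for x
    unfolding f'_def using smooth_on_has_derivative[OF U f that]
    by (intro bounded_linear_Blinfun_apply has_derivative_bounded_linear)
  have lin: "linear (frechet_derivative f (at x))" if "x \<in> U" for x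
    using smooth_on_has_derivative[OF U f that] has_derivative_linear by blast
  have df: "(f has_derivative blinfun_apply (f' x)) (at x)" if "x \<in> U" for x
    using smooth_on_has_derivative[OF U f that] f'[OF that] by simp
  have cont: "continuous_on U f'"
  proof (rule continuous_on_blinfun_componentwise)
    show "continuous_on U (\<lambda>x. blinfun_apply (f' x) i)" for i
      using smooth_on_imp_continuous_on[OF smooth_on_frechet_derivative[OF f, of i]] f'
      by (simp cong: continuous_on_cong)
  qed
  obtain ai where ai: "linear ai" "\<And>u. ai (frechet_derivative f (at x0) u) = u"
    using linear_injective_isomorphism[OF lin[OF x0] inj] by metis
  have "Blinfun ai o\<^sub>L f' x0 = id_blinfun"
    by (rule blinfun_eqI)
      (simp add: f'[OF x0] bounded_linear_Blinfun_apply linear_conv_bounded_linear[THEN iffD1, OF ai(1)] ai(2))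
  then obtain U' V g g' where UV: "open U'" "U' \<subseteq> U" "x0 \<in> U'" "open V" "homeomorphism U' V f g"
    and g: "\<And>y. y \<in> V \<Longrightarrow> (g has_derivative (g' y)) (at y)"
      "\<And>y. y \<in> V \<Longrightarrow> g' y = inv (blinfun_apply (f' (g y)))"
      "\<And>y. y \<in> V \<Longrightarrow> bij (blinfun_apply (f' (g y)))"
    using inverse_function_theorem[OF U df cont x0] by metis
  have gV: "g y \<in> U'" if "y \<in> V" for y
    using that UV(5) by (auto simp: homeomorphism_def)
  have gU: "g y \<in> U" if "y \<in> V" for y
    using gV[OF that] UV(2) by blast
  have bij: "bij (frechet_derivative f (at (g y)))" if "y \<in> V" for y
    using g(3)[OF that] f'[OF gU[OF that]] by simp
  have "Ck_on k V g" for k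
  proof (induction k)
    case 0
    then show ?case using UV(5) by (simp add: homeomorphism_def)
  next
    case (Suc k)
    have "Ck_on k V (\<lambda>y. g' y h)" for h
    proof (rule Ck_on_solve_linear[OF UV(4)])
      show "linear (frechet_derivative f (at (g y)))" "inj (frechet_derivative f (at (g y)))"
        if "y \<in> V" for y
        using that lin gU bij by (auto simp: bij_is_inj)
      show "Ck_on k V (\<lambda>y. frechet_derivative f (at (g y)) u)" for u
        using smooth_on_frechet_derivative[OF f, of u] gU
        by (intro Ck_on_compose[OF UV(4) U _ Suc, of "\<lambda>x. frechet_derivative f (at x) u"])
          (auto simp: smooth_on_def)
      show "Ck_on k V (\<lambda>y. h)" using UV(4) by (rule Ck_on_const)
      show "frechet_derivative f (at (g y)) (g' y h) = h" if "y \<in> V" for y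
        using bij[OF that] f'[OF gU[OF that]] g(2)[OF that] by (simp add: bij_is_surj surj_f_inv_f)
    qed
    with g(1) show ?case by (rule Ck_on_SucI[OF UV(4)])
  qed
  then have "smooth_on V g" by (simp add: smooth_on_def)
  with UV show ?thesis by (rule that)
qed


section \<open>Partial derivatives of a coordinate Lagrangian\<close>

text \<open>The partial derivatives are defined on slices. The chain rule along the affine
  embeddings of the slices expresses them through the total derivative \<open>D\<close>, and
  linearity reassembles \<open>D\<close> from them.\<close>

lemma D_eq_frechet_derivative:
  fixes l :: "'n::finite coord_lagrangian"
  assumes "((\<lambda>(x, y, z, w). l x y z w) has_derivative D) (at (x, y, z, w))"
  shows "D1 l x y z w = (\<chi> i. D (axis i 1, 0, 0, 0))" "D2 l x y z w = (\<chi> i. D (0, axis i 1, 0, 0))"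
    "D3 l x y z w = D (0, 0, 1, 0)" "D4 l x y z w = D (0, 0, 0, 1)"
    "D (dx, dy, dz, dw) = D1 l x y z w \<bullet> dx + D2 l x y z w \<bullet> dy + D3 l x y z w * dz + D4 l x y z w * dw"
proof -
  interpret D: linear D using assms by (rule has_derivative_linear)
  have has_derivative_slice:
    "((\<lambda>x'. (x', y, z, w)) has_derivative (\<lambda>u. (u, 0, 0, 0))) (at x)"
    "((\<lambda>y'. (x, y', z, w)) has_derivative (\<lambda>u. (0, u, 0, 0))) (at y)"
    "((\<lambda>z'. (x, y, z', w)) has_derivative (\<lambda>u. (0, 0, u, 0))) (at z)"
    "((\<lambda>w'. (x, y, z, w')) has_derivative (\<lambda>u. (0, 0, 0, u))) (at w)"
    by (intro has_derivative_Pair has_derivative_ident has_derivative_const)+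
  have "((\<lambda>x'. l x' y z w) has_derivative (\<lambda>u. D (u, 0, 0, 0))) (at x)"
    using diff_chain_at[OF has_derivative_slice(1) assms] by (simp add: o_def)
  then show D1: "D1 l x y z w = (\<chi> i. D (axis i 1, 0, 0, 0))"
    by (simp add: D1_def grad_def frechet_derivative_at[symmetric])
  have "((\<lambda>y'. l x y' z w) has_derivative (\<lambda>u. D (0, u, 0, 0))) (at y)"
    using diff_chain_at[OF has_derivative_slice(2) assms] by (simp add: o_def)
  then show D2: "D2 l x y z w = (\<chi> i. D (0, axis i 1, 0, 0))"
    by (simp add: D2_def grad_def frechet_derivative_at[symmetric])
  have "((\<lambda>z'. l x y z' w) has_derivative (\<lambda>u. D (0, 0, u, 0))) (at z)"
    using diff_chain_at[OF has_derivative_slice(3) assms] by (simp add: o_def)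
  moreover have "(\<lambda>u. D (0, 0, u, 0)) = (*) (D (0, 0, 1, 0))"
  proof
    show "D (0, 0, u, 0) = D (0, 0, 1, 0) * u" for u using D.scale[of u "(0, 0, 1, 0)"] by simp
  qed
  ultimately show D3: "D3 l x y z w = D (0, 0, 1, 0)"
    unfolding D3_def by (intro DERIV_imp_deriv) (simp add: has_field_derivative_def)
  have "((\<lambda>w'. l x y z w') has_derivative (\<lambda>u. D (0, 0, 0, u))) (at w)"
    using diff_chain_at[OF has_derivative_slice(4) assms] by (simp add: o_def)
  moreover have "(\<lambda>u. D (0, 0, 0, u)) = (*) (D (0, 0, 0, 1))"
  proof
    show "D (0, 0, 0, u) = D (0, 0, 0, 1) * u" for u using D.scale[of u "(0, 0, 0, 1)"] by simp
  qed
  ultimately show D4: "D4 l x y z w = D (0, 0, 0, 1)"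
    unfolding D4_def by (intro DERIV_imp_deriv) (simp add: has_field_derivative_def)
  have expand: "T u = (\<chi> i. T (axis i 1)) \<bullet> u" if "linear T" for T :: "real^'n \<Rightarrow> real" and u
  proof -
    have "T u = T (\<Sum>i\<in>UNIV. u $ i *\<^sub>R axis i 1)"
      by (simp add: basis_expansion flip: scalar_mult_eq_scaleR)
    then show ?thesis
      by (simp add: linear_sum[OF that] linear_scale[OF that] inner_vec_def mult.commute)
  qed
  have "D (dx, dy, dz, dw) = D (dx, 0, 0, 0) + D (0, dy, 0, 0) + D (dz *\<^sub>R (0, 0, 1, 0)) + D (dw *\<^sub>R (0, 0, 0, 1))"
    by (simp flip: D.add)
  also have "D (dx, 0, 0, 0) = D1 l x y z w \<bullet> dx"
    unfolding D1 using D.add[of "(_, 0, 0, 0)" "(_, 0, 0, 0)"] D.scale[of _ "(_, 0, 0, 0)"]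
    by (intro expand) (simp add: linear_iff)
  also have "D (0, dy, 0, 0) = D2 l x y z w \<bullet> dy"
    unfolding D2 using D.add[of "(0, _, 0, 0)" "(0, _, 0, 0)"] D.scale[of _ "(0, _, 0, 0)"]
    by (intro expand) (simp add: linear_iff)
  finally show "D (dx, dy, dz, dw) = D1 l x y z w \<bullet> dx + D2 l x y z w \<bullet> dy + D3 l x y z w * dz + D4 l x y z w * dw"
    by (simp only: D3 D4 D.scale real_scaleR_def mult.commute)
qed

text \<open>On \<open>S\<close> each partial derivative is the total derivative in fixed directions,
  which is smooth because all derivatives of a smooth map are.\<close>

lemma smooth_on_D:
  fixes l :: "'n::finite coord_lagrangian"
  assumes S: "open S" and l: "smooth_on S (\<lambda>(x, y, z, w). l x y z w)"
  shows "smooth_on S (\<lambda>(x, y, z, w). D1 l x y z w)" "smooth_on S (\<lambda>(x, y, z, w). D2 l x y z w)"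
    "smooth_on S (\<lambda>(x, y, z, w). D3 l x y z w)" "smooth_on S (\<lambda>(x, y, z, w). D4 l x y z w)"
proof -
  let ?D = "\<lambda>q. frechet_derivative (\<lambda>(x, y, z, w). l x y z w) (at q)"
  have D: "((\<lambda>(x, y, z, w). l x y z w) has_derivative ?D (x, y, z, w)) (at (x, y, z, w))"
    if "(x, y, z, w) \<in> S" for x y z w
    using smooth_on_has_derivative[OF S l that] .
  have vec: "smooth_on S (\<lambda>q. \<chi> i. ?D q (b i))" for b :: "'n \<Rightarrow> _"
  proof -
    have "(\<lambda>q. \<chi> i. ?D q (b i)) = (\<lambda>q. \<Sum>i\<in>UNIV. ?D q (b i) *\<^sub>R axis i 1)"
      using basis_expansion[of "\<chi> i. ?D _ (b i)"] by (simp add: scalar_mult_eq_scaleR fun_eq_iff)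
    then show ?thesis
      by (auto intro!: smooth_on_sum smooth_on_scaleR smooth_on_frechet_derivative l smooth_on_const S)
  qed
  show "smooth_on S (\<lambda>(x, y, z, w). D1 l x y z w)"
    by (rule smooth_on_cong[OF S _ vec[of "\<lambda>i. (axis i 1, 0, 0, 0)"]])
      (auto simp: D_eq_frechet_derivative(1)[OF D])
  show "smooth_on S (\<lambda>(x, y, z, w). D2 l x y z w)"
    by (rule smooth_on_cong[OF S _ vec[of "\<lambda>i. (0, axis i 1, 0, 0)"]])
      (auto simp: D_eq_frechet_derivative(2)[OF D])
  show "smooth_on S (\<lambda>(x, y, z, w). D3 l x y z w)"
    by (rule smooth_on_cong[OF S _ smooth_on_frechet_derivative[OF l, of "(0, 0, 1, 0)"]])
      (auto simp: D_eq_frechet_derivative(3)[OF D])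
  show "smooth_on S (\<lambda>(x, y, z, w). D4 l x y z w)"
    by (rule smooth_on_cong[OF S _ smooth_on_frechet_derivative[OF l, of "(0, 0, 0, 1)"]])
      (auto simp: D_eq_frechet_derivative(4)[OF D])
qed


section \<open>One step of the discrete flow\<close>

text \<open>The setting is shared by the two consecutive steps and is interpreted once for each.
  \<open>S\<close> is the domain of the Lagrangian and \<open>U\<close> a domain on which the branch
  \<open>\<zeta>\<close> solves for the new \<open>z\<close>; the factors with \<open>D3\<close> and
  \<open>D4\<close> are controlled only along the graph of this branch.\<close>

locale discrete_step =
  fixes h :: real and l :: "'n::finite coord_lagrangian"
    and S :: "((real^'n) \<times> (real^'n) \<times> real \<times> real) set" and U :: "((real^'n) \<times> (real^'n) \<times> real) set"
    and \<zeta> :: "real^'n \<Rightarrow> real^'n \<Rightarrow> real \<Rightarrow> real"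
  assumes open_S: "open S" and smooth_l: "smooth_on S (\<lambda>(x, y, z, w). l x y z w)"
    and open_U: "open U" and smooth_\<zeta>: "smooth_on U (\<lambda>(x, y, z). \<zeta> x y z)"
    and in_S: "(x, y, z) \<in> U \<Longrightarrow> (x, y, z, \<zeta> x y z) \<in> S"
    and z_rel: "(x, y, z) \<in> U \<Longrightarrow> z_rel h l x y z (\<zeta> x y z)"
    and D4_nz: "(x, y, z) \<in> U \<Longrightarrow> 1 - h * D4 l x y z (\<zeta> x y z) \<noteq> 0"
    and D3_nz: "(x, y, z) \<in> U \<Longrightarrow> 1 + h * D3 l x y z (\<zeta> x y z) \<noteq> 0"
begin

section \<open>Smoothness and derivatives of the Legendre transforms\<close>

lemma smooth_on_coordinates:
  "smooth_on U fst" "smooth_on U (\<lambda>m. fst (snd m))" "smooth_on U (\<lambda>m. snd (snd m))"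
  using open_U by (auto intro!: smooth_on_linear bounded_linear_intros)

text \<open>The map is \<open>g\<close> composed with the graph embedding of \<open>\<zeta>\<close>,
  which is smooth and takes \<open>U\<close> into \<open>S\<close>.\<close>

lemma smooth_on_graph:
  assumes "smooth_on S (\<lambda>(x, y, z, w). g x y z w)"
  shows "smooth_on U (\<lambda>(x, y, z). g x y z (\<zeta> x y z))"
proof -
  have "smooth_on U (\<lambda>m. (fst m, fst (snd m), snd (snd m), case m of (x, y, z) \<Rightarrow> \<zeta> x y z))"
    by (intro smooth_on_Pair open_U smooth_on_coordinates smooth_\<zeta>)
  then have "smooth_on U (\<lambda>m. case (fst m, fst (snd m), snd (snd m), case m of (x, y, z) \<Rightarrow> \<zeta> x y z) of
      (x, y, z, w) \<Rightarrow> g x y z w)"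
    using assms by (rule smooth_on_compose[OF open_U open_S, rotated]) (auto intro: in_S)
  then show ?thesis by (simp add: case_prod_unfold)
qed

lemma smooth_on_p_plus: "smooth_on U (\<lambda>(x, y, z). p_plus h l x y z (\<zeta> x y z))"
proof -
  have "smooth_on U (\<lambda>m. (- h * inverse (1 + h * (case m of (x, y, z) \<Rightarrow> D3 l x y z (\<zeta> x y z)))) *\<^sub>R
      (case m of (x, y, z) \<Rightarrow> D1 l x y z (\<zeta> x y z)))"
    using D3_nz
    by (intro smooth_on_scaleR[OF open_U] smooth_on_inverse[OF open_U] smooth_on_add[OF open_U] open_U
        smooth_on_const smooth_on_graph smooth_on_D[OF open_S smooth_l]
        smooth_on_bounded_linear[OF open_U bounded_linear_mult_right]) auto
  then show ?thesis by (rule smooth_on_cong[OF open_U, rotated]) (auto simp: p_plus_def divide_inverse)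
qed

lemma smooth_on_p_minus: "smooth_on U (\<lambda>(x, y, z). p_minus h l x y z (\<zeta> x y z))"
proof -
  have "smooth_on U (\<lambda>m. (h * inverse (1 + (- h) * (case m of (x, y, z) \<Rightarrow> D4 l x y z (\<zeta> x y z)))) *\<^sub>R
      (case m of (x, y, z) \<Rightarrow> D2 l x y z (\<zeta> x y z)))"
    using D4_nz
    by (intro smooth_on_scaleR[OF open_U] smooth_on_inverse[OF open_U] smooth_on_add[OF open_U] open_U
        smooth_on_const smooth_on_graph smooth_on_D[OF open_S smooth_l]
        smooth_on_bounded_linear[OF open_U bounded_linear_mult_right]) auto
  then show ?thesis by (rule smooth_on_cong[OF open_U, rotated]) (auto simp: p_minus_def divide_inverse)
qed

lemma smooth_on_leg_plus: "smooth_on U (leg_plus h l \<zeta>)"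
  using smooth_on_Pair[OF open_U smooth_on_coordinates(1)
      smooth_on_Pair[OF open_U smooth_on_p_plus smooth_on_coordinates(3)]]
  by (simp add: leg_plus_def case_prod_unfold)

lemma smooth_on_leg_minus: "smooth_on U (leg_minus h l \<zeta>)"
  using smooth_on_Pair[OF open_U smooth_on_coordinates(2)
      smooth_on_Pair[OF open_U smooth_on_p_minus smooth_\<zeta>]]
  by (simp add: leg_minus_def case_prod_unfold)

lemma frechet_derivative_leg_plus:
  assumes "m \<in> U"
  shows "frechet_derivative (leg_plus h l \<zeta>) (at m) (dx, dy, dz) =
    (dx, frechet_derivative (\<lambda>(x, y, z). p_plus h l x y z (\<zeta> x y z)) (at m) (dx, dy, dz), dz)"
proof -
  have "(leg_plus h l \<zeta> has_derivative (\<lambda>u. (fst u,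
      frechet_derivative (\<lambda>(x, y, z). p_plus h l x y z (\<zeta> x y z)) (at m) u, snd (snd u)))) (at m)"
    using has_derivative_Pair[OF bounded_linear_imp_has_derivative[OF bounded_linear_fst]
        has_derivative_Pair[OF smooth_on_has_derivative[OF open_U smooth_on_p_plus assms]
          bounded_linear_imp_has_derivative[OF bounded_linear_snd_comp[OF bounded_linear_snd]]]]
    by (simp add: leg_plus_def case_prod_unfold)
  from frechet_derivative_at[OF this, symmetric] show ?thesis by simp
qed

lemma frechet_derivative_leg_minus:
  assumes "m \<in> U"
  shows "frechet_derivative (leg_minus h l \<zeta>) (at m) (dx, dy, dz) =
    (dy, frechet_derivative (\<lambda>(x, y, z). p_minus h l x y z (\<zeta> x y z)) (at m) (dx, dy, dz),
      frechet_derivative (\<lambda>(x, y, z). \<zeta> x y z) (at m) (dx, dy, dz))"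
proof -
  have "(leg_minus h l \<zeta> has_derivative (\<lambda>u. (fst (snd u),
      frechet_derivative (\<lambda>(x, y, z). p_minus h l x y z (\<zeta> x y z)) (at m) u,
      frechet_derivative (\<lambda>(x, y, z). \<zeta> x y z) (at m) u))) (at m)"
    using has_derivative_Pair[OF bounded_linear_imp_has_derivative[OF bounded_linear_fst_comp[OF bounded_linear_snd]]
        has_derivative_Pair[OF smooth_on_has_derivative[OF open_U smooth_on_p_minus assms]
          smooth_on_has_derivative[OF open_U smooth_\<zeta> assms]]]
    by (simp add: leg_minus_def case_prod_unfold)
  from frechet_derivative_at[OF this, symmetric] show ?thesis by simp
qed

section \<open>The contact form under the Legendre transforms\<close>

text \<open>The relation defining \<open>\<zeta>\<close> holds identically on the open set
  \<open>U\<close>, so it may be differentiated there.\<close>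

lemma implicit_derivative_\<zeta>:
  fixes dx dy :: "real^'n" and dz :: real
  assumes "(x, y, z) \<in> U"
  defines "w \<equiv> \<zeta> x y z"
  defines "dw \<equiv> frechet_derivative (\<lambda>(x, y, z). \<zeta> x y z) (at (x, y, z)) (dx, dy, dz)"
  shows "dw - dz = h * (D1 l x y z w \<bullet> dx + D2 l x y z w \<bullet> dy + D3 l x y z w * dz + D4 l x y z w * dw)"
proof -
  let ?Z = "frechet_derivative (\<lambda>(x, y, z). \<zeta> x y z) (at (x, y, z))"
  let ?D = "frechet_derivative (\<lambda>(x, y, z, w). l x y z w) (at (x, y, z, w))"
  let ?e = "\<lambda>m. (fst m, fst (snd m), snd (snd m), case m of (x, y, z) \<Rightarrow> \<zeta> x y z)"
  have Z: "((\<lambda>(x, y, z). \<zeta> x y z) has_derivative ?Z) (at (x, y, z))"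
    by (rule smooth_on_has_derivative[OF open_U smooth_\<zeta> assms(1)])
  have D: "((\<lambda>(x, y, z, w). l x y z w) has_derivative ?D) (at (x, y, z, w))"
    using smooth_on_has_derivative[OF open_S smooth_l in_S[OF assms(1)]] by (simp add: w_def)
  have "(?e has_derivative (\<lambda>u. (fst u, fst (snd u), snd (snd u), ?Z u))) (at (x, y, z))"
    by (intro has_derivative_Pair Z bounded_linear_imp_has_derivative bounded_linear_intros)
  from diff_chain_at[OF this, of "\<lambda>(x, y, z, w). l x y z w" ?D] D
  have "((\<lambda>m. case ?e m of (x, y, z, w) \<Rightarrow> l x y z w) has_derivative
      (\<lambda>u. ?D (fst u, fst (snd u), snd (snd u), ?Z u))) (at (x, y, z))"
    by (simp add: o_def w_def)
  then have "((\<lambda>m. (case m of (x, y, z) \<Rightarrow> \<zeta> x y z) - snd (snd m) - h * (case ?e m of (x, y, z, w) \<Rightarrow> l x y z w))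
      has_derivative (\<lambda>u. ?Z u - snd (snd u) - h * ?D (fst u, fst (snd u), snd (snd u), ?Z u))) (at (x, y, z))"
    by (intro has_derivative_diff Z has_derivative_mult_right bounded_linear_imp_has_derivative bounded_linear_intros)
  \<comment> \<open>By \<open>z_rel\<close> the differentiated map agrees with zero on
    \<open>U\<close>. The computed expression is thus a derivative of the zero map and vanishes by
    uniqueness.\<close>
  then have "((\<lambda>m. 0) has_derivative
      (\<lambda>u. ?Z u - snd (snd u) - h * ?D (fst u, fst (snd u), snd (snd u), ?Z u))) (at (x, y, z))"
    by (rule has_derivative_transform_within_open[OF _ open_U assms(1)])
      (use z_rel in \<open>auto simp: z_rel_def\<close>)
  then have "?Z u - snd (snd u) - h * ?D (fst u, fst (snd u), snd (snd u), ?Z u) = 0" for u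
    by (rule fun_cong[OF has_derivative_unique[OF _ has_derivative_const]])
  from this[of "(dx, dy, dz)"] show ?thesis
    using D_eq_frechet_derivative(5)[OF D, of dx dy dz dw] by (simp add: dw_def)
qed

text \<open>The two sides evaluate \<open>dw - p\<^sup>- dy\<close> and
  \<open>dz - p\<^sup>+ dx\<close>; the form has no \<open>dp\<close> part, so the derivatives of
  the momenta do not enter. Once the differentiated relation is solved for \<open>dw\<close>, the
  \<open>D2\<close> term cancels against \<open>p\<^sup>-\<close>, and factoring out
  \<open>1 + h D3\<close> turns the \<open>D1\<close> term into the one of
  \<open>p\<^sup>+\<close>.\<close>

lemma contact_form_leg_minus:
  assumes "(x, y, z) \<in> U"
  shows "contact_form (leg_minus h l \<zeta> (x, y, z)) (frechet_derivative (leg_minus h l \<zeta>) (at (x, y, z)) u) =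
    (1 + h * D3 l x y z (\<zeta> x y z)) / (1 - h * D4 l x y z (\<zeta> x y z)) *
    contact_form (leg_plus h l \<zeta> (x, y, z)) (frechet_derivative (leg_plus h l \<zeta>) (at (x, y, z)) u)"
proof -
  obtain dx dy dz where u: "u = (dx, dy, dz)" by (cases u)
  define dw where "dw = frechet_derivative (\<lambda>(x, y, z). \<zeta> x y z) (at (x, y, z)) (dx, dy, dz)"
  define w where "w = \<zeta> x y z"
  have nz: "1 - h * D4 l x y z w \<noteq> 0" "1 + h * D3 l x y z w \<noteq> 0"
    using D4_nz[OF assms] D3_nz[OF assms] by (simp_all add: w_def)
  have "dw - dz = h * (D1 l x y z w \<bullet> dx + D2 l x y z w \<bullet> dy + D3 l x y z w * dz + D4 l x y z w * dw)"
    using implicit_derivative_\<zeta>[OF assms] by (simp add: w_def dw_def)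
  then have dw: "(1 - h * D4 l x y z w) * dw =
      (1 + h * D3 l x y z w) * dz + h * (D1 l x y z w \<bullet> dx) + h * (D2 l x y z w \<bullet> dy)"
    by (simp add: algebra_simps)
  have cf: "contact_form (a, p, c) (da, dp, dc) = dc - p \<bullet> da" for a p da dp :: "real^'n" and c dc
    by (simp add: contact_form_def inner_vec_def)
  have "contact_form (leg_minus h l \<zeta> (x, y, z)) (frechet_derivative (leg_minus h l \<zeta>) (at (x, y, z)) u) =
      dw - h / (1 - h * D4 l x y z w) * (D2 l x y z w \<bullet> dy)"
    unfolding u frechet_derivative_leg_minus[OF assms] by (simp add: leg_minus_def cf p_minus_def dw_def w_def)
  also have "\<dots> = ((1 + h * D3 l x y z w) * dz + h * (D1 l x y z w \<bullet> dx)) / (1 - h * D4 l x y z w)"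
    using nz(1) dw by (simp add: field_simps)
  also have "\<dots> = (1 + h * D3 l x y z w) / (1 - h * D4 l x y z w) *
      (dz + h / (1 + h * D3 l x y z w) * (D1 l x y z w \<bullet> dx))"
    using nz by (simp add: divide_simps)
  also have "dz + h / (1 + h * D3 l x y z w) * (D1 l x y z w \<bullet> dx) =
      contact_form (leg_plus h l \<zeta> (x, y, z)) (frechet_derivative (leg_plus h l \<zeta>) (at (x, y, z)) u)"
    unfolding u frechet_derivative_leg_plus[OF assms] by (simp add: leg_plus_def cf p_plus_def w_def)
  finally show ?thesis by (simp add: w_def)
qed

text \<open>Since \<open>leg_plus\<close> after \<open>g\<close> is the identity on the open set
  \<open>W\<close>, its derivative at \<open>g m\<close> undoes that of \<open>g\<close>. With
  \<open>u\<close> taken as the image of \<open>v\<close> under the derivative of \<open>g\<close>,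
  \<open>contact_form_leg_minus\<close> becomes the claim, and \<open>f\<close> is its factor at
  \<open>g m\<close>.\<close>

lemma contact_transformation_on_leg_minus_comp:
  assumes W: "open W" and g: "smooth_on W g" and gU: "g ` W \<subseteq> U"
    and right_inverse: "\<And>m. m \<in> W \<Longrightarrow> leg_plus h l \<zeta> (g m) = m"
  shows "contact_transformation_on W (\<lambda>m. leg_minus h l \<zeta> (g m))"
proof -
  define f where "f m = (case g m of (x, y, z) \<Rightarrow>
    (1 + h * D3 l x y z (\<zeta> x y z)) / (1 - h * D4 l x y z (\<zeta> x y z)))" for m
  have "f m \<noteq> 0 \<and> (\<forall>v. pullback (\<lambda>m. leg_minus h l \<zeta> (g m)) contact_form m v = f m * contact_form m v)"
    if m: "m \<in> W" for m
  proof -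
    obtain x y z where q: "g m = (x, y, z)" by (cases "g m")
    have U: "(x, y, z) \<in> U" using gU m q by force
    let ?g' = "frechet_derivative g (at m)"
    have g': "(g has_derivative ?g') (at m)" by (rule smooth_on_has_derivative[OF W g m])
    have "((\<lambda>m. leg_plus h l \<zeta> (g m)) has_derivative
        (\<lambda>v. frechet_derivative (leg_plus h l \<zeta>) (at (x, y, z)) (?g' v))) (at m)"
      using diff_chain_at[OF g', of "leg_plus h l \<zeta>"] smooth_on_has_derivative[OF open_U smooth_on_leg_plus U]
      by (simp add: q o_def)
    then have "((\<lambda>m. m) has_derivative
        (\<lambda>v. frechet_derivative (leg_plus h l \<zeta>) (at (x, y, z)) (?g' v))) (at m)"
      by (rule has_derivative_transform_within_open[OF _ W m]) (rule right_inverse)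
    then have plus: "frechet_derivative (leg_plus h l \<zeta>) (at (x, y, z)) (?g' v) = v" for v
      by (rule fun_cong[OF has_derivative_unique[OF _ has_derivative_ident]])
    have "((\<lambda>m. leg_minus h l \<zeta> (g m)) has_derivative
        (\<lambda>v. frechet_derivative (leg_minus h l \<zeta>) (at (x, y, z)) (?g' v))) (at m)"
      using diff_chain_at[OF g', of "leg_minus h l \<zeta>"] smooth_on_has_derivative[OF open_U smooth_on_leg_minus U]
      by (simp add: q o_def)
    note minus = frechet_derivative_at[OF this, symmetric]
    have "pullback (\<lambda>m. leg_minus h l \<zeta> (g m)) contact_form m v = f m * contact_form m v" for v
      using contact_form_leg_minus[OF U, of "?g' v"] right_inverse[OF m]
      by (simp add: pullback_def minus plus q f_def)
    moreover have "f m \<noteq> 0" using D3_nz[OF U] D4_nz[OF U] by (simp add: f_def q)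
    ultimately show ?thesis by blast
  qed
  moreover have "smooth_on W (\<lambda>m. leg_minus h l \<zeta> (g m))"
    by (rule smooth_on_compose[OF W open_U gU g smooth_on_leg_minus])
  ultimately show ?thesis unfolding contact_transformation_on_def by blast
qed

section \<open>Local invertibility of \<open>leg_plus\<close>\<close>

lemma has_derivative_p_plus_slice:
  assumes "(x, y, z) \<in> U"
  shows "((\<lambda>y'. p_plus h l x y' z (\<zeta> x y' z)) has_derivative
    (\<lambda>u. frechet_derivative (\<lambda>(x, y, z). p_plus h l x y z (\<zeta> x y z)) (at (x, y, z)) (0, u, 0))) (at y)"
proof -
  have "((\<lambda>y'. (x, y', z)) has_derivative (\<lambda>u. (0, u, 0))) (at y)"
    by (intro has_derivative_Pair has_derivative_ident has_derivative_const)
  from diff_chain_at[OF this smooth_on_has_derivative[OF open_U smooth_on_p_plus assms]]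
  show ?thesis by (simp add: o_def)
qed

lemma p_plus_solvable_iff_inj:
  assumes "(x, y, z) \<in> U"
  shows "p_plus_solvable h l \<zeta> x y z \<longleftrightarrow> inj (frechet_derivative (\<lambda>y'. p_plus h l x y' z (\<zeta> x y' z)) (at y))"
  unfolding p_plus_solvable_def jacobian_def
    frechet_derivative_at[OF has_derivative_p_plus_slice[OF assms], symmetric]
  by (rule det_nz_iff_inj[OF has_derivative_linear[OF has_derivative_p_plus_slice[OF assms]]])

text \<open>The derivative passes \<open>dx\<close> and \<open>dz\<close> through unchanged. A
  kernel vector therefore has the form \<open>(0, dy, 0)\<close>, and the partial derivative of
  \<open>p\<^sup>+\<close> in \<open>y\<close> is injective by solvability.\<close>

lemma inj_frechet_derivative_leg_plus:
  assumes "(x, y, z) \<in> U" "p_plus_solvable h l \<zeta> x y z"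
  shows "inj (frechet_derivative (leg_plus h l \<zeta>) (at (x, y, z)))"
proof -
  let ?P = "frechet_derivative (\<lambda>(x, y, z). p_plus h l x y z (\<zeta> x y z)) (at (x, y, z))"
  have inj: "inj (\<lambda>u. ?P (0, u, 0))"
    using assms(2) unfolding p_plus_solvable_iff_inj[OF assms(1)]
      frechet_derivative_at[OF has_derivative_p_plus_slice[OF assms(1)], symmetric] .
  have lin: "linear (frechet_derivative (leg_plus h l \<zeta>) (at (x, y, z)))" "linear ?P"
    using smooth_on_has_derivative[OF open_U smooth_on_leg_plus assms(1)]
      smooth_on_has_derivative[OF open_U smooth_on_p_plus assms(1)] has_derivative_linear by blast+
  have "u = 0" if "frechet_derivative (leg_plus h l \<zeta>) (at (x, y, z)) u = 0" for u
  proof -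
    obtain dx dy dz where u: "u = (dx, dy, dz)" by (cases u)
    have "dx = 0" "dz = 0" "?P (0, dy, 0) = ?P (0, 0, 0)"
      using that linear_0[OF lin(2)] unfolding u frechet_derivative_leg_plus[OF assms(1)]
      by (auto simp: zero_prod_def)
    with injD[OF inj, of dy 0] show ?thesis by (simp add: u zero_prod_def)
  qed
  then show ?thesis by (simp add: linear_injective_0[OF lin(1)])
qed

end

section \<open>The Euler-Lagrange equations as matching of momenta\<close>

lemma dgel_lhs_eq:
  assumes "h \<noteq> 0" "1 + h * D3 k x1 x2 z1 z2 \<noteq> 0"
  shows "dgel_lhs h l k x0 x1 x2 z0 z1 z2 =
    ((1 + h * D3 k x1 x2 z1 z2) / h) *\<^sub>R (p_minus h l x0 x1 z0 z1 - p_plus h k x1 x2 z1 z2)"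
  using assms by (simp add: dgel_lhs_def p_minus_def p_plus_def scaleR_add_right)

lemma dgel_solution_iff:
  assumes "h \<noteq> 0" "1 + h * D3 k x1 x2 z1 z2 \<noteq> 0"
  shows "dgel_solution h l k x0 x1 x2 z0 z1 z2 \<longleftrightarrow>
    z_rel h l x0 x1 z0 z1 \<and> z_rel h k x1 x2 z1 z2 \<and> p_minus h l x0 x1 z0 z1 = p_plus h k x1 x2 z1 z2"
  using assms by (auto simp: dgel_solution_def dgel_lhs_eq)

text \<open>As \<open>p\<^sup>-\<close> depends only on the earlier step, it is constant in
  \<open>y\<close>. At a solution the Jacobian of the Euler-Lagrange expression is thus a scalar
  multiple of that of \<open>p\<^sup>+\<close>, and injectivity of the multiple forces injectivity
  of \<open>P\<close>.\<close>

lemma (in discrete_step) p_plus_solvable_if_dgel_jacobian: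
  assumes "h \<noteq> 0" and m: "(x1, x2, z1) \<in> U" and "p_minus h l' x0 x1 z0 z1 = p_plus h l x1 x2 z1 (\<zeta> x1 x2 z1)"
    and det: "det (jacobian (\<lambda>y. dgel_lhs h l' l x0 x1 y z0 z1 (\<zeta> x1 y z1)) (at x2)) \<noteq> 0"
  shows "p_plus_solvable h l \<zeta> x1 x2 z1"
proof -
  define s where "s y = (1 + h * D3 l x1 y z1 (\<zeta> x1 y z1)) / h" for y
  define P where "P = frechet_derivative (\<lambda>y'. p_plus h l x1 y' z1 (\<zeta> x1 y' z1)) (at x2)"
  \<comment> \<open>This slice of \<open>U\<close> is a neighbourhood of \<open>x2\<close> on which
    \<open>1 + h D3\<close> stays nonzero along the branch, so the factorization of
    \<open>dgel_lhs\<close> holds there and may be differentiated.\<close>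
  define T where "T = {y. (x1, y, z1) \<in> U}"
  have "T = (\<lambda>y. (x1, y, z1)) -` U" by (auto simp: T_def)
  then have "open T" by (auto intro!: open_vimage open_U continuous_on_Pair continuous_on_const continuous_on_id)
  moreover have "x2 \<in> T" using m by (simp add: T_def)
  ultimately have T: "open T" "x2 \<in> T" .
  have P: "((\<lambda>y'. p_plus h l x1 y' z1 (\<zeta> x1 y' z1)) has_derivative P) (at x2)"
    unfolding P_def frechet_derivative_at[OF has_derivative_p_plus_slice[OF m], symmetric]
    by (rule has_derivative_p_plus_slice[OF m])
  have "smooth_on U (\<lambda>(x, y, z). D3 l x y z (\<zeta> x y z))"
    by (intro smooth_on_graph smooth_on_D open_S smooth_l)
  then obtain D where D: "((\<lambda>(x, y, z). D3 l x y z (\<zeta> x y z)) has_derivative D) (at (x1, x2, z1))"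
    using smooth_on_has_derivative[OF open_U _ m] by blast
  have "((\<lambda>y. D3 l x1 y z1 (\<zeta> x1 y z1)) has_derivative (\<lambda>u. D (0, u, 0))) (at x2)"
    using diff_chain_at[OF has_derivative_Pair[OF has_derivative_const
          has_derivative_Pair[OF has_derivative_ident has_derivative_const]] D]
    by (simp add: o_def)
  then obtain s' where s': "(s has_derivative s') (at x2)"
    unfolding s_def[abs_def] using assms(1) by (force intro!: derivative_eq_intros)
  \<comment> \<open>The second factor of \<open>dgel_lhs = s (p\<^sup>- - p\<^sup>+)\<close> vanishes at \<open>x2\<close>, so the derivative of \<open>s\<close> drops out.\<close>
  have "((\<lambda>y. s y *\<^sub>R (p_minus h l' x0 x1 z0 z1 - p_plus h l x1 y z1 (\<zeta> x1 y z1))) has_derivative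
      (\<lambda>u. - s x2 *\<^sub>R P u)) (at x2)"
    using has_derivative_scaleR[OF s' has_derivative_diff[OF has_derivative_const[of "p_minus h l' x0 x1 z0 z1"] P]]
      assms(3) by simp
  then have J: "((\<lambda>y. dgel_lhs h l' l x0 x1 y z0 z1 (\<zeta> x1 y z1)) has_derivative (\<lambda>u. - s x2 *\<^sub>R P u)) (at x2)"
    by (rule has_derivative_transform_within_open[OF _ T])
      (auto simp: dgel_lhs_eq[OF assms(1) D3_nz] T_def s_def)
  have "inj (\<lambda>u. - s x2 *\<^sub>R P u)"
    using det det_nz_iff_inj[OF has_derivative_linear[OF J]]
    by (simp add: jacobian_def frechet_derivative_at[OF J, symmetric])
  then have "inj P" by (auto simp: inj_def)
  then show ?thesis unfolding p_plus_solvable_iff_inj[OF m] P_def .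
qed

section \<open>From charts to a discrete step\<close>

text \<open>The neighbourhood given by \<open>resolves_z\<close> is cut down to the chart images,
  where the step size conditions are available. The set \<open>V\<close> is kept because the
  relation singles out \<open>\<zeta>\<close> only among values in \<open>V\<close>.\<close>

lemma discrete_step_in_charts:
  fixes A :: "('q::{t2_space, second_countable_topology}, 'n::finite) chart set"
  assumes "smooth_atlas A" "smooth_lagrangian A L" "sufficiently_small_step A L h" "c \<in> A" "d \<in> A"
    and "x \<in> img c" "y \<in> img d" and "resolves_z h (in_charts L c d) x y z w \<zeta>"
  obtains U V where "discrete_step h (in_charts L c d) (img c \<times> img d \<times> UNIV \<times> UNIV) U \<zeta>"
    "U \<subseteq> img c \<times> img d \<times> UNIV" "(x, y, z) \<in> U" "open V" "w \<in> V"
    "\<And>x y z w. (x, y, z) \<in> U \<Longrightarrow> w \<in> V \<Longrightarrow> z_rel h (in_charts L c d) x y z w \<longleftrightarrow> w = \<zeta> x y z"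
    "\<And>x y z. (x, y, z) \<in> U \<Longrightarrow> \<zeta> x y z \<in> V"
proof -
  obtain N V where N: "open N" "(x, y, z) \<in> N" "open V" "w \<in> V" "smooth_on N (\<lambda>(x', y', z'). \<zeta> x' y' z')"
    "\<forall>(x', y', z')\<in>N. \<zeta> x' y' z' \<in> V \<and>
           (\<forall>w'\<in>V. z_rel h (in_charts L c d) x' y' z' w' \<longleftrightarrow> w' = \<zeta> x' y' z')"
    using assms(8) unfolding resolves_z_def by blast
  define U where "U = N \<inter> img c \<times> img d \<times> UNIV"
  have oc: "open (img c)" "open (img d)" using assms(1,4,5) by (auto simp: smooth_atlas_def)
  have V: "z_rel h (in_charts L c d) x y z w \<longleftrightarrow> w = \<zeta> x y z" "\<zeta> x y z \<in> V"
    if "(x, y, z) \<in> U" "w \<in> V" for x y z w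
    using N(6) that by (auto simp: U_def)
  have rel: "z_rel h (in_charts L c d) x y z (\<zeta> x y z)" if "(x, y, z) \<in> U" for x y z
    using N(4) V[OF that] by blast
  have "discrete_step h (in_charts L c d) (img c \<times> img d \<times> UNIV \<times> UNIV) U \<zeta>"
  proof
    show "open (img c \<times> img d \<times> (UNIV :: real set) \<times> (UNIV :: real set))"
      by (intro open_Times oc open_UNIV)
    show "smooth_on (img c \<times> img d \<times> UNIV \<times> UNIV) (\<lambda>(x, y, z, w). in_charts L c d x y z w)"
      using assms(2,4,5) unfolding smooth_lagrangian_def by blast
    show "open U" unfolding U_def by (intro open_Int N(1) open_Times oc open_UNIV)
    show "smooth_on U (\<lambda>(x, y, z). \<zeta> x y z)" using N(5) by (rule smooth_on_subset) (simp add: U_def)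
    fix x y z assume m: "(x, y, z) \<in> U"
    then show "(x, y, z, \<zeta> x y z) \<in> img c \<times> img d \<times> UNIV \<times> UNIV" by (simp add: U_def)
    show r: "z_rel h (in_charts L c d) x y z (\<zeta> x y z)" using rel[OF m] .
    from m have "x \<in> img c" "y \<in> img d" by (auto simp: U_def)
    then show "1 - h * D4 (in_charts L c d) x y z (\<zeta> x y z) \<noteq> 0"
      "1 + h * D3 (in_charts L c d) x y z (\<zeta> x y z) \<noteq> 0"
      using conjunct1[OF assms(3)[unfolded sufficiently_small_step_def], rule_format, OF assms(4,5) _ _ r]
      by blast+
  qed
  moreover have "U \<subseteq> img c \<times> img d \<times> UNIV" by (simp add: U_def)
  moreover have "(x, y, z) \<in> U" using N(2) assms(6,7) by (simp add: U_def)
  ultimately show ?thesis by (rule that[OF _ _ _ N(3,4) V(1) V(2)[OF _ N(4)]])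
qed

section \<open>The induced map and its contact property\<close>

theorem theorem2:
  fixes A :: "('q::{t2_space, second_countable_topology}, 'n::finite) chart set"
    and L :: "'q \<Rightarrow> 'q \<Rightarrow> real \<Rightarrow> real \<Rightarrow> real"
    and h :: real
    and c0 c1 c2 :: "('q, 'n) chart"
    and x0 x1 x2 :: "real^'n"
    and z0 z1 z2 :: real
    and \<zeta> \<zeta>' :: "real^'n \<Rightarrow> real^'n \<Rightarrow> real \<Rightarrow> real"
    and l k :: "'n coord_lagrangian"
  defines "l \<equiv> in_charts L c0 c1" and "k \<equiv> in_charts L c1 c2"
  assumes "smooth_atlas A"
    and "smooth_lagrangian A L"
    and "nondegenerate A L"
    and "h > 0"
    and "sufficiently_small_step A L h"
    and "c0 \<in> A" and "c1 \<in> A" and "c2 \<in> A"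
    and "x0 \<in> img c0" and "x1 \<in> img c1" and "x2 \<in> img c2"
    and "dgel_solution h l k x0 x1 x2 z0 z1 z2"
    and "resolves_z h l x0 x1 z0 z1 \<zeta>"
    and "resolves_z h k x1 x2 z1 z2 \<zeta>'"
  shows "p_minus h l x0 x1 z0 z1 = p_plus h k x1 x2 z1 z2 \<and>
    p_plus_solvable h k \<zeta>' x1 x2 z1 \<and>
    (p_plus_solvable h l \<zeta> x0 x1 z0 \<longrightarrow>
      (\<exists>N M \<Phi> W F.
         open N \<and> (x0, x1, z0) \<in> N \<and> N \<subseteq> img c0 \<times> img c1 \<times> UNIV \<and>
         open M \<and> (x1, x2, z1) \<in> M \<and> M \<subseteq> img c1 \<times> img c2 \<times> UNIV \<and>
         smooth_on N \<Phi> \<and> \<Phi> ` N \<subseteq> M \<and> \<Phi> (x0, x1, z0) = (x1, x2, z1) \<and>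
         (\<forall>(x, y, z)\<in>N. \<forall>(y', u, w)\<in>M.
            \<Phi> (x, y, z) = (y', u, w) \<longleftrightarrow>
              y' = y \<and> dgel_solution h l k x y u z w (\<zeta>' y u w)) \<and>
         open W \<and> W \<subseteq> img c0 \<times> UNIV \<times> UNIV \<and>
         bij_betw (leg_plus h l \<zeta>) N W \<and>
         (\<forall>m\<in>N. F (leg_plus h l \<zeta> m) = leg_minus h l \<zeta> m \<and>
                 F (leg_plus h l \<zeta> m) = leg_plus h k \<zeta>' (\<Phi> m)) \<and>
         contact_transformation_on W F))"
proof -
  note A = assms(3) and L = assms(4) and small = assms(7) and charts = assms(8-13) and sol = assms(14)
  obtain U\<^sub>l V where "discrete_step h l (img c0 \<times> img c1 \<times> UNIV \<times> UNIV) U\<^sub>l \<zeta>"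
    and U\<^sub>l: "U\<^sub>l \<subseteq> img c0 \<times> img c1 \<times> UNIV" "(x0, x1, z0) \<in> U\<^sub>l" and V: "open V" "z1 \<in> V"
    and rel: "\<And>x y z w. (x, y, z) \<in> U\<^sub>l \<Longrightarrow> w \<in> V \<Longrightarrow> z_rel h l x y z w \<longleftrightarrow> w = \<zeta> x y z"
    using discrete_step_in_charts[OF A L small charts(1,2,4,5) assms(15)[unfolded l_def]]
    unfolding l_def by metis
  then interpret l: discrete_step h l "img c0 \<times> img c1 \<times> UNIV \<times> UNIV" U\<^sub>l \<zeta> by blast
  obtain U\<^sub>k V' where "discrete_step h k (img c1 \<times> img c2 \<times> UNIV \<times> UNIV) U\<^sub>k \<zeta>'"
    and U\<^sub>k: "U\<^sub>k \<subseteq> img c1 \<times> img c2 \<times> UNIV" "(x1, x2, z1) \<in> U\<^sub>k" and V': "z2 \<in> V'"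
    and rel': "\<And>x y z w. (x, y, z) \<in> U\<^sub>k \<Longrightarrow> w \<in> V' \<Longrightarrow> z_rel h k x y z w \<longleftrightarrow> w = \<zeta>' x y z"
    using discrete_step_in_charts[OF A L small charts(2,3,5,6) assms(16)[unfolded k_def]]
    unfolding k_def by metis
  then interpret k: discrete_step h k "img c1 \<times> img c2 \<times> UNIV \<times> UNIV" U\<^sub>k \<zeta>' by blast
  have h: "h \<noteq> 0" using assms(6) by simp
  \<comment> \<open>The values of the given solution lie in \<open>V\<close> and \<open>V'\<close>,
    hence on the branches \<open>\<zeta>\<close> and \<open>\<zeta>'\<close>.\<close>
  have z1: "z1 = \<zeta> x0 x1 z0" and z2: "z2 = \<zeta>' x1 x2 z1"
    using sol rel[OF U\<^sub>l(2) V(2)] rel'[OF U\<^sub>k(2) V'] by (simp_all add: dgel_solution_def)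
  have p_eq: "p_minus h l x0 x1 z0 z1 = p_plus h k x1 x2 z1 z2"
    using sol dgel_solution_iff[OF h k.D3_nz[OF U\<^sub>k(2)]] by (simp add: z2)
  have "det (jacobian (\<lambda>y. dgel_lhs h l k x0 x1 y z0 z1 (\<zeta>' x1 y z1)) (at x2)) \<noteq> 0"
    using conjunct2[OF small[unfolded sufficiently_small_step_def], rule_format, OF charts
        sol[unfolded l_def k_def] assms(16)[unfolded k_def]]
    unfolding l_def k_def .
  with p_eq have solvable: "p_plus_solvable h k \<zeta>' x1 x2 z1"
    unfolding z2 by (intro k.p_plus_solvable_if_dgel_jacobian[OF h U\<^sub>k(2)])
  have "\<exists>N M \<Phi> W F.
         open N \<and> (x0, x1, z0) \<in> N \<and> N \<subseteq> img c0 \<times> img c1 \<times> UNIV \<and>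
         open M \<and> (x1, x2, z1) \<in> M \<and> M \<subseteq> img c1 \<times> img c2 \<times> UNIV \<and>
         smooth_on N \<Phi> \<and> \<Phi> ` N \<subseteq> M \<and> \<Phi> (x0, x1, z0) = (x1, x2, z1) \<and>
         (\<forall>(x, y, z)\<in>N. \<forall>(y', u, w)\<in>M.
            \<Phi> (x, y, z) = (y', u, w) \<longleftrightarrow>
              y' = y \<and> dgel_solution h l k x y u z w (\<zeta>' y u w)) \<and>
         open W \<and> W \<subseteq> img c0 \<times> UNIV \<times> UNIV \<and>
         bij_betw (leg_plus h l \<zeta>) N W \<and>
         (\<forall>m\<in>N. F (leg_plus h l \<zeta> m) = leg_minus h l \<zeta> m \<and>
                 F (leg_plus h l \<zeta> m) = leg_plus h k \<zeta>' (\<Phi> m)) \<and>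
         contact_transformation_on W F"
    if solvable\<^sub>l: "p_plus_solvable h l \<zeta> x0 x1 z0"
  proof -
    \<comment> \<open>The inverse \<open>g\<^sub>l\<close> recovers the next point from an initial
      point and its momentum; here the solvability at the first step enters.\<close>
    obtain N\<^sub>l W\<^sub>l g\<^sub>l where N\<^sub>l: "open N\<^sub>l" "N\<^sub>l \<subseteq> U\<^sub>l" "(x0, x1, z0) \<in> N\<^sub>l" "open W\<^sub>l"
      "homeomorphism N\<^sub>l W\<^sub>l (leg_plus h l \<zeta>) g\<^sub>l" "smooth_on W\<^sub>l g\<^sub>l"
      using smooth_inverse_function[OF l.open_U l.smooth_on_leg_plus U\<^sub>l(2)
          l.inj_frechet_derivative_leg_plus[OF U\<^sub>l(2) solvable\<^sub>l]] by metis
    \<comment> \<open>Restricting the \<open>z\<close> entry to \<open>V\<close> makes the relation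
      of the first step equivalent to \<open>w = \<zeta> x y z\<close> for all triples in
      \<open>M\<close>. The characterization of \<open>\<Phi>\<close> relies on this.\<close>
    define U\<^sub>k' where "U\<^sub>k' = U\<^sub>k \<inter> (\<lambda>m. snd (snd m)) -` V"
    have "open U\<^sub>k'"
      unfolding U\<^sub>k'_def using V(1) k.open_U
      by (intro open_Int open_vimage continuous_on_snd continuous_on_id)
    moreover have "smooth_on U\<^sub>k' (leg_plus h k \<zeta>')"
      using k.smooth_on_leg_plus by (rule smooth_on_subset) (simp add: U\<^sub>k'_def)
    moreover have "(x1, x2, z1) \<in> U\<^sub>k'" using U\<^sub>k(2) V(2) by (simp add: U\<^sub>k'_def)
    ultimately obtain M P g\<^sub>k where M: "open M" "M \<subseteq> U\<^sub>k'" "(x1, x2, z1) \<in> M" "open P"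
      "homeomorphism M P (leg_plus h k \<zeta>') g\<^sub>k" "smooth_on P g\<^sub>k"
      using smooth_inverse_function[OF _ _ _ k.inj_frechet_derivative_leg_plus[OF U\<^sub>k(2) solvable]] by metis
    have g\<^sub>l: "leg_plus h l \<zeta> m \<in> W\<^sub>l" "g\<^sub>l (leg_plus h l \<zeta> m) = m" if "m \<in> N\<^sub>l" for m
      using N\<^sub>l(5) that by (auto simp: homeomorphism_def)
    have g\<^sub>l': "g\<^sub>l m \<in> N\<^sub>l" "leg_plus h l \<zeta> (g\<^sub>l m) = m" if "m \<in> W\<^sub>l" for m
      using N\<^sub>l(5) that by (auto simp: homeomorphism_def)
    have g\<^sub>k: "leg_plus h k \<zeta>' m \<in> P" "g\<^sub>k (leg_plus h k \<zeta>' m) = m" if "m \<in> M" for m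
      using M(5) that by (auto simp: homeomorphism_def)
    have g\<^sub>k': "g\<^sub>k m \<in> M" "leg_plus h k \<zeta>' (g\<^sub>k m) = m" if "m \<in> P" for m
      using M(5) that by (auto simp: homeomorphism_def)
    \<comment> \<open>\<open>N\<close> keeps the points whose \<open>leg_minus\<close> image lies in
      \<open>P\<close>, the domain of \<open>g\<^sub>k\<close>. \<open>W\<close> is the image of
      \<open>N\<close> under \<open>leg_plus\<close>, written as a preimage under
      \<open>g\<^sub>l\<close> so that its openness follows from continuity.\<close>
    define N where "N = N\<^sub>l \<inter> leg_minus h l \<zeta> -` P"
    define W where "W = W\<^sub>l \<inter> g\<^sub>l -` N"
    define \<Phi> where "\<Phi> m = g\<^sub>k (leg_minus h l \<zeta> m)" for m
    define F where "F m = leg_minus h l \<zeta> (g\<^sub>l m)" for m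
    have minus_N: "smooth_on N (leg_minus h l \<zeta>)"
      using l.smooth_on_leg_minus by (rule smooth_on_subset) (use N\<^sub>l(2) in \<open>auto simp: N_def\<close>)
    have open_N: "open N"
      unfolding N_def using N\<^sub>l(1,2) M(4) smooth_on_imp_continuous_on[OF l.smooth_on_leg_minus]
      by (intro continuous_open_preimage) (auto intro: continuous_on_subset)
    have open_W: "open W"
      unfolding W_def using N\<^sub>l(4,6) open_N by (intro continuous_open_preimage smooth_on_imp_continuous_on)
    \<comment> \<open>The positions and the \<open>z\<close> values coincide on the branches, so
      this is exactly the equality of momenta; it puts the base point into \<open>N\<close>.\<close>
    have base: "leg_minus h l \<zeta> (x0, x1, z0) = leg_plus h k \<zeta>' (x1, x2, z1)"
      using p_eq by (simp add: leg_minus_def leg_plus_def z1[symmetric] z2[symmetric])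
    have base_N: "(x0, x1, z0) \<in> N" using g\<^sub>k(1)[OF M(3)] N\<^sub>l(3) by (simp add: N_def base)
    have N_sub: "N \<subseteq> img c0 \<times> img c1 \<times> UNIV" using N\<^sub>l(2) U\<^sub>l(1) by (auto simp: N_def)
    have M_sub: "M \<subseteq> img c1 \<times> img c2 \<times> UNIV" using M(2) U\<^sub>k(1) by (auto simp: U\<^sub>k'_def)
    have \<Phi>_smooth: "smooth_on N \<Phi>"
      unfolding \<Phi>_def by (rule smooth_on_compose[OF open_N M(4) _ minus_N M(6)]) (auto simp: N_def)
    have \<Phi>_M: "\<Phi> ` N \<subseteq> M" using g\<^sub>k'(1) by (auto simp: \<Phi>_def N_def)
    have \<Phi>_base: "\<Phi> (x0, x1, z0) = (x1, x2, z1)" by (simp add: \<Phi>_def base g\<^sub>k(2)[OF M(3)])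
    have \<Phi>_iff: "\<Phi> (x, y, z) = (y', u, w) \<longleftrightarrow> y' = y \<and> dgel_solution h l k x y u z w (\<zeta>' y u w)"
      if "(x, y, z) \<in> N" "(y', u, w) \<in> M" for x y z y' u w
    proof -
      have mem: "(x, y, z) \<in> U\<^sub>l" "(y', u, w) \<in> U\<^sub>k" "w \<in> V" "leg_minus h l \<zeta> (x, y, z) \<in> P"
        using that N\<^sub>l(2) M(2) by (auto simp: N_def U\<^sub>k'_def)
      have "\<Phi> (x, y, z) = (y', u, w) \<longleftrightarrow> leg_minus h l \<zeta> (x, y, z) = leg_plus h k \<zeta>' (y', u, w)"
        using g\<^sub>k(2)[OF that(2)] g\<^sub>k'(2)[OF mem(4)] unfolding \<Phi>_def by metis
      \<comment> \<open>Componentwise, the transforms agree when position, momentum and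
        \<open>z\<close> do. The \<open>z\<close> condition is the relation of the first step, that
        of the second holds along \<open>\<zeta>'\<close>, and the momentum condition is the
        Euler-Lagrange equation.\<close>
      also have "\<dots> \<longleftrightarrow> y' = y \<and> w = \<zeta> x y z \<and> p_minus h l x y z w = p_plus h k y' u w (\<zeta>' y' u w)"
        by (auto simp: leg_minus_def leg_plus_def)
      also have "\<dots> \<longleftrightarrow> y' = y \<and> dgel_solution h l k x y' u z w (\<zeta>' y' u w)"
        using dgel_solution_iff[OF h k.D3_nz[OF mem(2)]] k.z_rel[OF mem(2)] rel[OF mem(1,3)] by auto
      finally show ?thesis by auto
    qed
    have W_image: "leg_plus h l \<zeta> ` N = W"
    proof
      show "leg_plus h l \<zeta> ` N \<subseteq> W" using g\<^sub>l by (auto simp: W_def N_def)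
      show "W \<subseteq> leg_plus h l \<zeta> ` N" using g\<^sub>l' by (force simp: W_def)
    qed
    have W_sub: "W \<subseteq> img c0 \<times> UNIV \<times> UNIV"
      using N_sub by (auto simp: leg_plus_def simp flip: W_image)
    have bij: "bij_betw (leg_plus h l \<zeta>) N W"
      using W_image g\<^sub>l(2) by (auto simp: bij_betw_def N_def intro!: inj_on_inverseI[of _ g\<^sub>l])
    \<comment> \<open>The second form of \<open>F\<close> holds because \<open>leg_plus\<close> of
      the second step undoes the \<open>g\<^sub>k\<close> in \<open>\<Phi>\<close>. The new momentum
      is therefore both \<open>p\<^sup>-\<close> of the first step and \<open>p\<^sup>+\<close> of
      the second.\<close>
    have F: "F (leg_plus h l \<zeta> m) = leg_minus h l \<zeta> m" "F (leg_plus h l \<zeta> m) = leg_plus h k \<zeta>' (\<Phi> m)"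
      if "m \<in> N" for m
      using that g\<^sub>l(2) g\<^sub>k'(2) by (simp_all add: F_def \<Phi>_def N_def)
    have contact: "contact_transformation_on W F"
      unfolding F_def[abs_def]
    proof (rule l.contact_transformation_on_leg_minus_comp[OF open_W])
      show "smooth_on W g\<^sub>l" using N\<^sub>l(6) by (rule smooth_on_subset) (simp add: W_def)
      show "g\<^sub>l ` W \<subseteq> U\<^sub>l" using N\<^sub>l(2) by (auto simp: W_def N_def)
      show "leg_plus h l \<zeta> (g\<^sub>l m) = m" if "m \<in> W" for m using that g\<^sub>l'(2) by (simp add: W_def)
    qed
    have \<Phi>_all: "\<forall>(x, y, z)\<in>N. \<forall>(y', u, w)\<in>M.
        \<Phi> (x, y, z) = (y', u, w) \<longleftrightarrow> y' = y \<and> dgel_solution h l k x y u z w (\<zeta>' y u w)"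
      by (intro ballI case_prodI2) (simp add: \<Phi>_iff)
    have F_all: "\<forall>m\<in>N. F (leg_plus h l \<zeta> m) = leg_minus h l \<zeta> m \<and>
        F (leg_plus h l \<zeta> m) = leg_plus h k \<zeta>' (\<Phi> m)"
      using F by simp
    show ?thesis
      by (rule exI[of _ N], rule exI[of _ M], rule exI[of _ \<Phi>], rule exI[of _ W], rule exI[of _ F])
        (intro conjI open_N base_N N_sub M(1,3) M_sub \<Phi>_smooth \<Phi>_M \<Phi>_base \<Phi>_all open_W W_sub bij F_all contact)
  qed
  with p_eq solvable show ?thesis by blast
qed

end
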